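(* Fix $p\in(0,1)\setminus\{1/2\}$ and $c>0$, and let $m=m_n=\lfloor c n^{3/2}\rfloor$. Then $$\lim_{n\to \infty}\operatorname{Ent}\big(\nu^{(p)}_{n,m_n}\big)=\frac{(2p-1)^2}{24c^2}.$$
   Context: $(m,p)$-shelf shuffle: a deck of cards labelled $1,\ldots,n$, arranged in increasing order from top to bottom, is dealt sequentially from the bottom (so the cards are dealt in the order $n,n-1,\ldots,1$). Each card is assigned one of $m$ labelled shelves, independently and uniformly at random, and is placed at the top of the existing pile on that shelf with probability $p$ and at the bottom of it with probability $1-p$, independently of everything else (a card assigned to an empty shelf simply starts the pile). The shuffled deck is formed by joining the piles in the order of the shelves $1,\ldots,m$, and is read from top to bottom as a permutation $\pi=(\pi_1,\ldots,\pi_n)\in S_n$ in one-line notation. The law of this random permutation is denoted $\nu_{n,m}^{(p)}$. For a probability measure $\mu$ on $S_n$, with $\nu_n$ the uniform measure on $S_n$, the relative entropy is $$\operatorname{Ent}(\mu)=\operatorname{Ent}(\mu\mid\nu_n)=\sum_{\pi\in S_n}\mu(\pi)\log\frac{\mu(\pi)}{\nu_n(\pi)},$$ with the convention $0\log 0=0$. *)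

theory Defs
  imports "HOL-Probability.Probability" "HOL-Combinatorics.Multiset_Permutations"
begin

text \<open>
  A configuration of piles maps a shelf to its pile, listed from top to bottom.
  Shelves are labelled 1, ..., m, so all statements are meant for m > 0.
\<close>

definition deal_card ::
    "nat \<Rightarrow> real \<Rightarrow> nat \<Rightarrow> (nat \<Rightarrow> nat list) \<Rightarrow> (nat \<Rightarrow> nat list) pmf" where
  "deal_card m p k P =
     bind_pmf (pmf_of_set {1..m}) (\<lambda>s.
     map_pmf (\<lambda>top. P(s := if top then k # P s else P s @ [k])) (bernoulli_pmf p))"

primrec deal_cards ::
    "nat \<Rightarrow> real \<Rightarrow> nat \<Rightarrow> (nat \<Rightarrow> nat list) \<Rightarrow> (nat \<Rightarrow> nat list) pmf" where
  "deal_cards m p 0 P = return_pmf P"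
| "deal_cards m p (Suc k) P = bind_pmf (deal_card m p (Suc k) P) (deal_cards m p k)"

definition shelf_shuffle :: "nat \<Rightarrow> nat \<Rightarrow> real \<Rightarrow> nat list pmf" where
  "shelf_shuffle n m p =
     map_pmf (\<lambda>P. concat (map P [1..<Suc m])) (deal_cards m p n (\<lambda>_. []))"

text \<open>
  The symmetric group is represented by one-line notation: \<open>permutations_of_set {1..n}\<close> is the
  set of lists in which each of 1, ..., n occurs exactly once. Since \<open>0 * ln 0 = 0\<close>, the
  convention for vanishing probabilities is built in.
\<close>

definition Ent :: "nat \<Rightarrow> nat list pmf \<Rightarrow> real" where
  "Ent n \<mu> =
     (\<Sum>\<pi>\<in>permutations_of_set {1..n}.
        pmf \<mu> \<pi> * ln (pmf \<mu> \<pi> / pmf (pmf_of_set (permutations_of_set {1..n})) \<pi>))"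

lemma mset_concat_upd:
  assumes "s \<in> {1..m}"
  shows "mset (concat (map (P(s := if t then k # P s else P s @ [k])) [1..<Suc m])) =
         add_mset k (mset (concat (map P [1..<Suc m])))"
proof -
  have *: "mset (concat (map Q [1..<Suc m])) = (\<Sum>i\<in>{1..m}. mset (Q i))"
    for Q :: "nat \<Rightarrow> 'a list"
    by (induction m) (simp_all add: add.commute)
  have "(\<Sum>i\<in>{1..m} - {s}. mset ((P(s := X)) i)) = (\<Sum>i\<in>{1..m} - {s}. mset (P i))" for X
    by (intro sum.cong) auto
  then show ?thesis unfolding *
    using assms sum.remove[of "{1..m}" s "\<lambda>i. mset (P i)"]
      sum.remove[of "{1..m}" s
        "\<lambda>i. mset ((P(s := if t then k # P s else P s @ [k])) i)"]
    by simp
qed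

lemma mset_deal_cards:
  assumes "m > 0" "Q \<in> set_pmf (deal_cards m p n P)"
  shows "mset (concat (map Q [1..<Suc m])) =
         mset [1..<Suc n] + mset (concat (map P [1..<Suc m]))"
  using assms(2)
proof (induction n arbitrary: P)
  case 0
  then show ?case by simp
next
  case (Suc k)
  then obtain P' where P': "P' \<in> set_pmf (deal_card m p (Suc k) P)"
      "Q \<in> set_pmf (deal_cards m p k P')"
    by auto
  then obtain s t where "s \<in> {1..m}"
      "P' = P(s := if t then Suc k # P s else P s @ [Suc k])"
    using assms(1) by (auto simp: deal_card_def)
  with mset_concat_upd[of s m P t "Suc k"]
  have "mset (concat (map P' [1..<Suc m])) =
        add_mset (Suc k) (mset (concat (map P [1..<Suc m])))"
    by simp
  with Suc.IH[OF P'(2)] show ?case by simp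
qed

lemma set_pmf_shelf_shuffle:
  assumes "m > 0"
  shows "set_pmf (shelf_shuffle n m p) \<subseteq> permutations_of_set {1..n}"
proof
  fix xs assume "xs \<in> set_pmf (shelf_shuffle n m p)"
  then obtain Q where "Q \<in> set_pmf (deal_cards m p n (\<lambda>_. []))"
      "xs = concat (map Q [1..<Suc m])"
    by (auto simp: shelf_shuffle_def)
  moreover have "concat (map (\<lambda>_. []) ys) = ([] :: nat list)" for ys :: "nat list"
    by (induction ys) simp_all
  ultimately have *: "mset xs = mset [1..<Suc n]"
    using mset_deal_cards[OF assms, of Q p n "\<lambda>_. []"] by (simp del: upt_Suc)
  have "set xs = {1..n}"
    using mset_eq_setD[OF *] by auto
  moreover have "distinct xs"
    using mset_eq_imp_distinct_iff[OF *] by simp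
  ultimately show "xs \<in> permutations_of_set {1..n}"
    by (simp add: permutations_of_set_def)
qed

end

theory Submission
  imports Defs "HOL-Computational_Algebra.Polynomial_FPS" "HOL-Real_Asymp.Real_Asymp"
begin

text \<open>
  Write \<open>\<rho> = n / m\<close> and \<open>q = 1 - p\<close>, and let \<open>A\<close>, \<open>D\<close>, \<open>V\<close> be the numbers of ascents, descents and
  valleys of a permutation \<open>\<pi>\<close>. Every card receives an independent label: its shelf, and whether it
  goes to the top or to the bottom. A pile consists of its top cards in increasing order followed by
  its bottom cards in decreasing order, so the deck is the list of cards sorted by label, and the
  probability of \<open>\<pi>\<close> is the probability that the labels read along \<open>\<pi>\<close> form a chain. A transfer
  recursion along \<open>\<pi>\<close>, which only has to remember the last label, evaluates this probability times
  \<open>m ^ n\<close> as the coefficient of \<open>x ^ m\<close> in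
  \<open>x * x ^ V * (p + q * x) ^ (A - V) * (q + p * x) ^ (D - V) / (1 - x) ^ (n + 1)\<close>.
  An ascent contributes \<open>p + q * x\<close> and a descent \<open>q + p * x\<close>, but a descent followed by an ascent
  contributes only \<open>x\<close>, since its three cards cannot all lie on one shelf
  (\<open>pmf_shelf_shuffle_eq_nth\<close>, \<open>last_label_gf_closed_form\<close>).

  Taking the coefficient is a linear functional on the numerator polynomial. It turns \<open>x ^ t\<close> into
  \<open>\<Prod>j<n. 1 + (j - t) / m\<close>, the density of the shuffle with \<open>p = 1\<close> at a permutation with \<open>t\<close>
  descents. Along \<open>t\<close> this sequence is nearly geometric with ratio \<open>1 - \<rho>\<close>, so a factor
  \<open>1 - c + c * x\<close> multiplies the functional by \<open>1 - c * \<rho> + O(\<rho>\<^sup>2)\<close> (\<open>ln_Lam_linear\<close>). There are about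
  \<open>n\<close> factors and \<open>n * \<rho>\<^sup>2\<close> has a positive limit, so these errors may not be added up; but pairing
  an ascent with a descent gives \<open>(p + q * x) * (q + p * x) = x + p * q * (1 - x)\<^sup>2\<close>, which multiplies the
  functional by \<open>1 + p * q * \<rho>\<^sup>2\<close> relative to \<open>x\<close>, with a smaller error (\<open>ln_Lam_pair\<close>). Only
  \<open>\<bar>A - D\<bar>\<close> factors stay unpaired. Hence the logarithm of the density with respect to the uniform
  measure is
  \<open>- n * \<rho>\<^sup>2 / 24 + (p - 1/2) * \<rho> * (A - D) + p * q * \<rho>\<^sup>2 * (D - V)\<close>
  up to \<open>O(\<rho> + n * \<rho> ^ 3 + \<rho>\<^sup>2 * \<bar>A - D\<bar>)\<close>, uniformly in \<open>\<pi>\<close> (\<open>ln_P_expansion\<close>).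

  The entropy is the expectation of this logarithm under the shuffle itself. The expectations that
  are needed come from swapping two adjacent entries of \<open>\<pi>\<close>: this preserves the uniform measure and
  changes the log-density by \<open>(2 * p - 1) * \<rho> * \<Delta>A + O(\<rho>\<^sup>2)\<close>, where \<open>\<Delta>A\<close> is the change of \<open>A\<close>
  (\<open>P_swap_at\<close>). Since this change is \<open>O(\<rho>)\<close>, each of three neighbouring entries is the smallest, or the
  median, with probability \<open>1/3 + O(\<rho>)\<close>, which gives \<open>E V = n / 3 + O(1 + n * \<rho>)\<close>. A swap reverses
  the sign of one step of \<open>\<pi>\<close>, so the term of order \<open>\<rho>\<close> in the swap identity gives
  \<open>E (A - D) = (2 * p - 1) * n * \<rho> / 6 + O(\<rho> + n * \<rho>\<^sup>2)\<close>; signs of distant steps are nearly uncorrelated,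
  so \<open>E \<bar>A - D\<bar>\<close> is \<open>o(n)\<close>. Collecting terms, the entropy is
  \<open>n * \<rho>\<^sup>2 * (- 1/24 + (2 * p - 1)\<^sup>2 / 12 + p * q / 6) = n * \<rho>\<^sup>2 * (2 * p - 1)\<^sup>2 / 24\<close> up to a vanishing
  error (\<open>Ent_estimate\<close>), and \<open>n * \<rho>\<^sup>2\<close> tends to \<open>1 / c\<^sup>2\<close> when \<open>m\<close> is asymptotic to \<open>c * n powr (3/2)\<close>.
\<close>

section \<open>The deck as a sorted list of independently labelled cards\<close>

definition label_pmf :: "nat \<Rightarrow> real \<Rightarrow> (nat \<times> bool) pmf" where
  "label_pmf m p = pair_pmf (pmf_of_set {1..m}) (bernoulli_pmf p)"

text \<open>
  The piles that result from dealing the cards \<open>k, ..., 1\<close> with labels \<open>l\<close> onto the piles \<open>P\<close>: later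
  cards are smaller, so the new cards on top of a pile increase and those below it decrease.
\<close>

definition piles :: "nat \<Rightarrow> (nat \<Rightarrow> nat list) \<Rightarrow> (nat \<Rightarrow> nat \<times> bool) \<Rightarrow> nat \<Rightarrow> nat list" where
  "piles k P l s = filter (\<lambda>i. l i = (s, True)) [1..<Suc k] @ P s @
     rev (filter (\<lambda>i. l i = (s, False)) [1..<Suc k])"

lemma piles_Suc:
  "piles (Suc k) P (l(Suc k := (s, t))) = piles k (P(s := if t then Suc k # P s else P s @ [Suc k])) l"
proof
  fix s'
  have *: "filter (\<lambda>i. (l(Suc k := (s, t))) i = b) [1..<Suc k] = filter (\<lambda>i. l i = b) [1..<Suc k]" for b
    by (intro filter_cong) auto
  have split: "[1..<Suc (Suc k)] = [1..<Suc k] @ [Suc k]" by simp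
  show "piles (Suc k) P (l(Suc k := (s, t))) s' =
      piles k (P(s := if t then Suc k # P s else P s @ [Suc k])) l s'"
    unfolding piles_def split filter_append * by (auto simp del: upt_Suc)
qed

text \<open>
  All randomness can be drawn in advance, since the label of a card does not depend on the piles
  that it meets.
\<close>

lemma deal_cards_eq_labels:
  "deal_cards m p k P = map_pmf (piles k P) (Pi_pmf {1..k} d (\<lambda>_. label_pmf m p))"
proof (induction k arbitrary: P)
  case 0
  have "piles 0 P (\<lambda>_. d) = P" by (auto simp: piles_def)
  then show ?case by simp
next
  case (Suc k)
  have "{1..Suc k} = insert (Suc k) {1..k}" by auto
  then show ?case
    by (simp only: deal_cards.simps deal_card_def Suc.IH Pi_pmf_insert'[of "{1..k}" "Suc k"]
        finite_atLeastAtMost atLeastAtMost_iff not_less_eq_eq not_le lessI simp_thms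
        label_pmf_def pair_pmf_def map_pmf_def bind_assoc_pmf bind_return_pmf piles_Suc
        Suc_n_not_le_n)
qed

text \<open>
  The order in which cards with labels \<open>l\<close> appear in the deck. On one shelf, top cards precede
  bottom cards, top cards increase and bottom cards decrease.
\<close>

definition before :: "(nat \<Rightarrow> nat \<times> bool) \<Rightarrow> nat \<Rightarrow> nat \<Rightarrow> bool" where
  "before l x y \<longleftrightarrow> fst (l x) < fst (l y) \<or> fst (l x) = fst (l y) \<and>
     (if snd (l x) then snd (l y) \<longrightarrow> x < y else \<not> snd (l y) \<and> y < x)"

lemma transp_before: "transp (before l)"
  by (rule transpI) (auto simp: before_def split: if_splits)

lemma before_asym: "before l x y \<Longrightarrow> \<not> before l y x"
  by (auto simp: before_def split: if_splits)

lemma sorted_wrt_unique: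
  assumes "\<And>x y. R x y \<Longrightarrow> \<not> R y x" "sorted_wrt R xs" "sorted_wrt R ys" "set xs = set ys"
  shows "xs = ys"
  using assms(2-4)
proof (induction xs arbitrary: ys)
  case Nil then show ?case by simp
next
  case (Cons x xs)
  then obtain y ys' where ys: "ys = y # ys'" by (cases ys) auto
  have irrefl: "\<not> R z z" for z using assms(1) by blast
  have "x = y"
    using Cons.prems ys assms(1) by simp (metis insertE insertI1)
  moreover have "x \<notin> set xs" "y \<notin> set ys'"
    using Cons.prems ys irrefl by fastforce+
  ultimately have "set xs = set ys'"
    using Cons.prems ys by auto
  with Cons.IH[of ys'] Cons.prems ys \<open>x = y\<close> show ?case by simp
qed

definition deck :: "nat \<Rightarrow> nat \<Rightarrow> (nat \<Rightarrow> nat \<times> bool) \<Rightarrow> nat list" where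
  "deck n m l = concat (map (piles n (\<lambda>_. []) l) [1..<Suc m])"

lemma set_piles: "set (piles n (\<lambda>_. []) l s) = {i\<in>{1..n}. fst (l i) = s}"
proof -
  have "l i = (s, True) \<or> l i = (s, False) \<longleftrightarrow> fst (l i) = s" for i
    by (cases "l i") auto
  then show ?thesis by (auto simp: piles_def simp del: upt_Suc)
qed

lemma sorted_piles: "sorted_wrt (before l) (piles n (\<lambda>_. []) l s)"
proof -
  have lt: "sorted_wrt (<) (filter (\<lambda>i. l i = (s, b)) [1..<Suc n])" for b
    by (intro sorted_wrt_filter) (simp del: upt_Suc)
  have "sorted_wrt (before l) (filter (\<lambda>i. l i = (s, True)) [1..<Suc n])"
    by (rule sorted_wrt_mono_rel[OF _ lt]) (auto simp: before_def simp del: upt_Suc)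
  moreover have "sorted_wrt (\<lambda>x y. before l y x) (filter (\<lambda>i. l i = (s, False)) [1..<Suc n])"
    by (rule sorted_wrt_mono_rel[OF _ lt]) (auto simp: before_def simp del: upt_Suc)
  moreover have "before l x y" if "l x = (s, True)" "l y = (s, False)" for x y
    using that by (simp add: before_def)
  ultimately show ?thesis
    by (auto simp: piles_def sorted_wrt_append sorted_wrt_rev simp del: upt_Suc)
qed

lemma set_deck: "(\<And>i. i \<in> {1..n} \<Longrightarrow> fst (l i) \<in> {1..m}) \<Longrightarrow> set (deck n m l) = {1..n}"
  by (force simp: deck_def set_piles simp del: upt_Suc)

lemma sorted_deck: "sorted_wrt (before l) (deck n m l)"
proof (induction m)
  case 0 then show ?case by (simp add: deck_def)
next
  case (Suc m)
  have "deck n (Suc m) l = deck n m l @ piles n (\<lambda>_. []) l (Suc m)"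
    by (simp add: deck_def)
  moreover have "before l x y" if "x \<in> set (deck n m l)" "y \<in> set (piles n (\<lambda>_. []) l (Suc m))" for x y
    using that by (auto simp: deck_def set_piles before_def simp del: upt_Suc)
  ultimately show ?case using Suc by (auto simp: sorted_wrt_append sorted_piles)
qed

text \<open>
  The deck is the only list of all cards that is sorted by \<open>before l\<close>, so the event that the deck
  equals \<open>\<pi>\<close> is a condition on labels of neighbours in \<open>\<pi>\<close> only. This is what makes a transfer
  recursion along \<open>\<pi>\<close> possible.
\<close>

lemma pmf_shelf_shuffle:
  assumes "m > 0" "set \<pi> = {1..n}"
  shows "pmf (shelf_shuffle n m p) \<pi> =
    measure_pmf.prob (Pi_pmf {1..n} d (\<lambda>_. label_pmf m p)) {l. sorted_wrt (before l) \<pi>}"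
proof -
  let ?M = "Pi_pmf {1..n} d (\<lambda>_. label_pmf m p)"
  have eq: "deck n m l = \<pi> \<longleftrightarrow> sorted_wrt (before l) \<pi>" if "l \<in> set_pmf ?M" for l
  proof -
    have "fst (l i) \<in> {1..m}" if "i \<in> {1..n}" for i
      using \<open>l \<in> set_pmf ?M\<close> that assms(1)
      by (auto simp: set_Pi_pmf label_pmf_def PiE_dflt_def)
    then have "set (deck n m l) = set \<pi>" using set_deck[of n l] assms by simp
    then show ?thesis
      using sorted_wrt_unique[OF before_asym sorted_deck] sorted_deck by metis
  qed
  have "shelf_shuffle n m p = map_pmf (deck n m) ?M"
    by (simp add: shelf_shuffle_def deal_cards_eq_labels[of m p n _ d] map_pmf_comp deck_def[abs_def] del: upt_Suc)
  then have "pmf (shelf_shuffle n m p) \<pi> = measure_pmf.prob ?M (deck n m -` {\<pi>})"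
    by (simp add: pmf_map)
  also have "\<dots> = measure_pmf.prob ?M {l. sorted_wrt (before l) \<pi>}"
    by (intro measure_pmf.finite_measure_eq_AE) (auto simp: AE_measure_pmf_iff eq)
  finally show ?thesis .
qed

section \<open>The probability of a permutation as a power series coefficient\<close>

text \<open>
  Conditioning on the label of one further card; this is the step of the transfer recursion.
\<close>

lemma prob_Pi_pmf_insert:
  assumes "finite S" "y \<notin> S"
  shows "measure_pmf.prob (Pi_pmf (insert y S) d (\<lambda>_. L)) {l. l y = a \<and> Q l} =
     pmf L a * measure_pmf.prob (Pi_pmf S d (\<lambda>_. L)) {l. Q (l(y := a))}"
proof -
  let ?M = "Pi_pmf S d (\<lambda>_. L)"
  have prob: "measure_pmf.prob M {l. R l} = pmf (map_pmf R M) True" for M and R :: "('a \<Rightarrow> 'b) \<Rightarrow> bool"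
    by (simp add: pmf_map vimage_def)
  have "measure_pmf.prob (Pi_pmf (insert y S) d (\<lambda>_. L)) {l. l y = a \<and> Q l} =
    pmf (bind_pmf L (\<lambda>z. map_pmf (\<lambda>l. z = a \<and> Q (l(y := z))) ?M)) True"
    unfolding prob Pi_pmf_insert'[OF assms]
    by (simp add: map_pmf_def bind_assoc_pmf bind_return_pmf)
  also have "\<dots> = (\<integral>z. indicator {a} z * measure_pmf.prob ?M {l. Q (l(y := a))} \<partial>L)"
    unfolding pmf_bind by (intro Bochner_Integration.integral_cong) (auto simp: prob[symmetric] indicator_def)
  also have "\<dots> = pmf L a * measure_pmf.prob ?M {l. Q (l(y := a))}"
    by (simp add: pmf.rep_eq)
  finally show ?thesis .
qed

lemma prob_partition:
  assumes "finite K" "\<And>l. l \<in> set_pmf M \<Longrightarrow> g l \<in> K"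
  shows "measure_pmf.prob M {l. Q l} = (\<Sum>k\<in>K. measure_pmf.prob M {l. g l = k \<and> Q l})"
proof -
  have "measure_pmf.prob M {l. Q l} = measure_pmf.prob M (\<Union>k\<in>K. {l. g l = k \<and> Q l})"
    using assms(2) by (intro measure_pmf.finite_measure_eq_AE) (auto simp: AE_measure_pmf_iff)
  also have "\<dots> = (\<Sum>k\<in>K. measure_pmf.prob M {l. g l = k \<and> Q l})"
    by (intro measure_pmf.finite_measure_finite_Union assms) (auto simp: disjoint_family_on_def)
  finally show ?thesis .
qed

abbreviation geo :: "real fps" where "geo \<equiv> Abs_fps (\<lambda>_. 1)"

lemma geo_nth: "fps_nth (geo * H) n = (\<Sum>i\<le>n. fps_nth H i)"
  by (simp add: mult.commute[of geo] fps_mult_nth atLeast0AtMost)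

lemma geo_X: "geo = 1 + fps_X * geo"
  by (rule fps_ext) (auto split: nat.split)

text \<open>
  The list is a permutation read backwards, so its head is the card that comes last. For a
  permutation of length \<open>n\<close>, the coefficient at \<open>s\<close> of the first (second) series is
  \<open>m ^ n\<close> times the probability that the labels form a chain and that the last card is a top
  (bottom) card of shelf \<open>s\<close>. As labels increase along the permutation, this does not depend on how
  many shelves follow, so \<open>m\<close> is absent. The term \<open>L\<close> accounts for a predecessor on an earlier shelf.
\<close>

fun last_label_gf :: "real \<Rightarrow> nat list \<Rightarrow> real fps \<times> real fps" where
  "last_label_gf p [] = (0, 0)"
| "last_label_gf p [x] = (fps_const p * (fps_X * geo), fps_const (1 - p) * (fps_X * geo))"
| "last_label_gf p (y # x # zs) =
    (let (F, G) = last_label_gf p (x # zs); L = fps_X * (geo * (F + G))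
     in (fps_const p * (L + (if x < y then F else 0)),
         fps_const (1 - p) * (L + F + (if y < x then G else 0))))"

lemma last_label_gf_nth_0: "fps_nth (fst (last_label_gf p xs)) 0 = 0 \<and> fps_nth (snd (last_label_gf p xs)) 0 = 0"
  by (induction p xs rule: last_label_gf.induct) (auto simp: Let_def split: prod.split)

lemma pmf_label: "s \<in> {1..m} \<Longrightarrow> 0 \<le> p \<Longrightarrow> p \<le> 1 \<Longrightarrow>
   pmf (label_pmf m p) (s, b) = (if b then p else 1 - p) / real m"
  by (cases b) (auto simp: label_pmf_def pmf_pair)

text \<open>
  Given the label of \<open>y\<close>, the chain condition on the remaining cards involves only the label of their
  head \<open>x\<close>, so summing over that label reproduces the recursion of \<open>last_label_gf\<close>.
\<close>

lemma prob_chain: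
  assumes "0 \<le> p" "p \<le> 1" "distinct (y # xs)" "s \<in> {1..m}"
  shows "measure_pmf.prob (Pi_pmf (set (y # xs)) d (\<lambda>_. label_pmf m p))
      {l. l y = (s, b) \<and> sorted_wrt (\<lambda>u v. before l v u) (y # xs)} =
    fps_nth ((if b then fst else snd) (last_label_gf p (y # xs))) s / real m ^ length (y # xs)"
  using assms(3,4)
proof (induction xs arbitrary: y s b)
  case Nil
  have "fps_nth (fps_X * geo) s = 1" using Nil by simp
  moreover have "measure_pmf.prob (Pi_pmf {y} d (\<lambda>_. label_pmf m p)) {l. l y = (s, b)} =
      pmf (label_pmf m p) (s, b)"
    using prob_Pi_pmf_insert[of "{}" y d "label_pmf m p" "(s, b)" "\<lambda>_. True"] by simp
  ultimately show ?case using assms Nil by (simp add: pmf_label)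
next
  case (Cons x zs)
  let ?L = "label_pmf m p" and ?M = "Pi_pmf (set (x # zs)) d (\<lambda>_. label_pmf m p)"
  let ?S = "\<lambda>l. sorted_wrt (\<lambda>u v. before l v u)"
  \<comment> \<open>the labels that the predecessor x may have when y has label (s, b)\<close>
  define C where "C = (\<lambda>s' b'. s' < s \<or> s' = s \<and> (if b' then b \<longrightarrow> x < y else \<not> b \<and> y < x))"
  define H where "H = (\<lambda>b'. (if b' then fst else snd) (last_label_gf p (x # zs)))"
  have y: "y \<notin> set (x # zs)" using Cons.prems by auto
  have transp: "transp (\<lambda>u v. before l v u)" for l
    using transp_before[of l] by (auto simp: transp_def)
  have sorted: "?S (l(y := (s, b))) (y # x # zs) \<longleftrightarrow> C (fst (l x)) (snd (l x)) \<and> ?S l (x # zs)" for l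
  proof -
    have "?S (l(y := (s, b))) (x # zs) \<longleftrightarrow> ?S l (x # zs)"
    proof -
      have "before (l(y := (s, b))) u v = before l u v" if "u \<in> set (x # zs)" "v \<in> set (x # zs)" for u v
        using y that by (auto simp: before_def)
      then show ?thesis
        using sorted_wrt_mono_rel[of "x # zs"] by (smt (verit, ccfv_threshold))
    qed
    moreover have "before (l(y := (s, b))) x y \<longleftrightarrow> C (fst (l x)) (snd (l x))"
      using y by (auto simp: before_def C_def)
    ultimately show ?thesis by (simp only: sorted_wrt2[OF transp])
  qed
  have "measure_pmf.prob (Pi_pmf (set (y # x # zs)) d (\<lambda>_. ?L)) {l. l y = (s, b) \<and> ?S l (y # x # zs)} =
     pmf ?L (s, b) * measure_pmf.prob ?M {l. C (fst (l x)) (snd (l x)) \<and> ?S l (x # zs)}"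
    using prob_Pi_pmf_insert[of "set (x # zs)" y d ?L "(s, b)" "\<lambda>l. ?S l (y # x # zs)"] y
    unfolding sorted by simp
  also have "measure_pmf.prob ?M {l. C (fst (l x)) (snd (l x)) \<and> ?S l (x # zs)} =
     (\<Sum>k\<in>{1..m} \<times> UNIV. measure_pmf.prob ?M {l. l x = k \<and> C (fst (l x)) (snd (l x)) \<and> ?S l (x # zs)})"
  proof (rule prob_partition)
    show "l x \<in> {1..m} \<times> UNIV" if "l \<in> set_pmf ?M" for l
      using that Cons.prems by (auto simp: set_Pi_pmf label_pmf_def PiE_dflt_def)
  qed auto
  also have "\<dots> = (\<Sum>k\<in>{1..m} \<times> UNIV. of_bool (C (fst k) (snd k)) * (fps_nth (H (snd k)) (fst k) / real m ^ length (x # zs)))"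
  proof (intro sum.cong refl)
    fix k :: "nat \<times> bool" assume k: "k \<in> {1..m} \<times> UNIV"
    have "{l. l x = k \<and> C (fst (l x)) (snd (l x)) \<and> ?S l (x # zs)} =
      (if C (fst k) (snd k) then {l. l x = (fst k, snd k) \<and> ?S l (x # zs)} else {})" by auto
    then show "measure_pmf.prob ?M {l. l x = k \<and> C (fst (l x)) (snd (l x)) \<and> ?S l (x # zs)} =
      of_bool (C (fst k) (snd k)) * (fps_nth (H (snd k)) (fst k) / real m ^ length (x # zs))"
      using Cons.IH[of x "fst k" "snd k"] k Cons.prems by (auto simp: H_def)
  qed
  also have "\<dots> = (\<Sum>s'=1..m. \<Sum>b'\<in>UNIV. of_bool (C s' b') * fps_nth (H b') s') / real m ^ length (x # zs)"
    unfolding sum_divide_distrib sum.cartesian_product by (intro sum.cong) auto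
  also have "(\<Sum>s'=1..m. \<Sum>b'\<in>UNIV. of_bool (C s' b') * fps_nth (H b') s') =
     (\<Sum>s'<s. fps_nth (H True + H False) s') + of_bool (b \<longrightarrow> x < y) * fps_nth (H True) s
       + of_bool (\<not> b \<and> y < x) * fps_nth (H False) s"
  proof -
    have "(\<Sum>s'=1..m. \<Sum>b'\<in>UNIV. of_bool (C s' b') * fps_nth (H b') s') =
      (\<Sum>s'\<in>{1..s}. \<Sum>b'\<in>UNIV. of_bool (C s' b') * fps_nth (H b') s')"
      using Cons.prems by (intro sum.mono_neutral_right) (auto simp: C_def)
    also have "{1..s} = insert s {1..<s}" using Cons.prems by auto
    also have "(\<Sum>s'\<in>insert s {1..<s}. \<Sum>b'\<in>UNIV. of_bool (C s' b') * fps_nth (H b') s') =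
       (\<Sum>b'\<in>UNIV. of_bool (C s b') * fps_nth (H b') s) + (\<Sum>s'\<in>{1..<s}. fps_nth (H True + H False) s')"
      by (subst sum.insert) (auto intro!: sum.cong simp: C_def UNIV_bool)
    also have "(\<Sum>s'\<in>{1..<s}. fps_nth (H True + H False) s') = (\<Sum>s'<s. fps_nth (H True + H False) s')"
      using last_label_gf_nth_0[of p "x # zs"]
      by (intro sum.mono_neutral_left) (auto simp: H_def not_less_eq_eq less_Suc_eq_0_disj Suc_le_eq)
    finally show ?thesis by (simp add: UNIV_bool C_def)
  qed
  also have "(\<Sum>s'<s. fps_nth (H True + H False) s') = fps_nth (fps_X * (geo * (H True + H False))) s"
    using Cons.prems by (cases s) (simp_all add: geo_nth lessThan_Suc_atMost)
  finally show ?case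
    using Cons.prems assms(1,2) by (cases b) (auto simp: pmf_label H_def Let_def case_prod_unfold)
qed

text \<open>
  Summing over the shelf of the last card is multiplication by the geometric series.
\<close>

lemma pmf_shelf_shuffle_eq_nth:
  assumes "0 \<le> p" "p \<le> 1" "m > 0" "n > 0" "distinct \<pi>" "set \<pi> = {1..n}"
  shows "pmf (shelf_shuffle n m p) \<pi> =
    fps_nth (geo * (fst (last_label_gf p (rev \<pi>)) + snd (last_label_gf p (rev \<pi>)))) m / real m ^ n"
proof -
  obtain y xs where yxs: "rev \<pi> = y # xs"
    using assms by (cases "rev \<pi>") auto
  have set: "{1..n} = set (y # xs)" using assms(6) yxs by (metis set_rev)
  have dist: "distinct (y # xs)" using assms(5) yxs by (metis distinct_rev)
  have len: "length (y # xs) = n" using distinct_card[OF dist, folded set] by simp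
  let ?M = "Pi_pmf {1..n} undefined (\<lambda>_. label_pmf m p)"
  let ?F = "fst (last_label_gf p (rev \<pi>))" and ?G = "snd (last_label_gf p (rev \<pi>))"
  have "pmf (shelf_shuffle n m p) \<pi> = measure_pmf.prob ?M {l. sorted_wrt (before l) (rev (y # xs))}"
    using pmf_shelf_shuffle[OF assms(3,6)] yxs by (metis rev_rev_ident)
  also have "\<dots> = measure_pmf.prob ?M {l. sorted_wrt (\<lambda>u v. before l v u) (y # xs)}"
    by (simp only: sorted_wrt_rev)
  also have "\<dots> = (\<Sum>k\<in>{1..m} \<times> UNIV. measure_pmf.prob ?M {l. l y = k \<and> sorted_wrt (\<lambda>u v. before l v u) (y # xs)})"
  proof (rule prob_partition)
    have "y \<in> {1..n}" unfolding set by simp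
    then show "l y \<in> {1..m} \<times> UNIV" if "l \<in> set_pmf ?M" for l
      using that assms(3) by (auto simp: set_Pi_pmf label_pmf_def PiE_dflt_def mem_Times_iff)
  qed auto
  also have "\<dots> = (\<Sum>k\<in>{1..m} \<times> UNIV. fps_nth ((if snd k then fst else snd) (last_label_gf p (rev \<pi>))) (fst k) / real m ^ n)"
    unfolding set
    by (intro sum.cong refl, clarify, subst prob_chain[OF assms(1,2) dist]) (auto simp: yxs len[simplified])
  also have "\<dots> = (\<Sum>s=1..m. \<Sum>b\<in>UNIV. fps_nth ((if b then fst else snd) (last_label_gf p (rev \<pi>))) s) / real m ^ n"
    unfolding sum_divide_distrib sum.cartesian_product by (intro sum.cong) auto
  also have "(\<Sum>s=1..m. \<Sum>b\<in>UNIV. fps_nth ((if b then fst else snd) (last_label_gf p (rev \<pi>))) s) = (\<Sum>s\<in>{1..m}. fps_nth (?F + ?G) s)"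
    by (simp add: UNIV_bool add.commute)
  also have "\<dots> = (\<Sum>s\<le>m. fps_nth (?F + ?G) s)"
    using last_label_gf_nth_0[of p "rev \<pi>"] by (intro sum.mono_neutral_left) (auto simp: not_less_eq_eq)
  finally show ?thesis by (simp add: geo_nth)
qed

definition ascents :: "nat list \<Rightarrow> nat" where
  "ascents \<pi> = (\<Sum>i<length \<pi> - 1. of_bool (\<pi> ! i < \<pi> ! Suc i))"

definition descents :: "nat list \<Rightarrow> nat" where
  "descents \<pi> = (\<Sum>i<length \<pi> - 1. of_bool (\<pi> ! Suc i < \<pi> ! i))"

definition valleys :: "nat list \<Rightarrow> nat" where
  "valleys \<pi> = (\<Sum>i<length \<pi> - 2. of_bool (\<pi> ! Suc i < \<pi> ! i \<and> \<pi> ! Suc i < \<pi> ! Suc (Suc i)))"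

lemma ascents_snoc: "ascents (ws @ [x, y]) = ascents (ws @ [x]) + of_bool (x < y)"
proof -
  have "(\<Sum>i<length ws. of_bool ((ws @ [x, y]) ! i < (ws @ [x, y]) ! Suc i)) =
     (\<Sum>i<length ws. of_bool ((ws @ [x]) ! i < (ws @ [x]) ! Suc i) :: nat)"
    by (intro sum.cong refl) (auto simp: nth_append nth_Cons' less_Suc_eq)
  moreover have "(ws @ [x, y]) ! Suc (length ws) = y" by (simp add: nth_append)
  ultimately show ?thesis by (simp add: ascents_def)
qed

lemma descents_snoc: "descents (ws @ [x, y]) = descents (ws @ [x]) + of_bool (y < x)"
proof -
  have "(\<Sum>i<length ws. of_bool ((ws @ [x, y]) ! Suc i < (ws @ [x, y]) ! i)) =
     (\<Sum>i<length ws. of_bool ((ws @ [x]) ! Suc i < (ws @ [x]) ! i) :: nat)"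
    by (intro sum.cong refl) (auto simp: nth_append nth_Cons' less_Suc_eq)
  moreover have "(ws @ [x, y]) ! Suc (length ws) = y" by (simp add: nth_append)
  ultimately show ?thesis by (simp add: descents_def)
qed

lemma valleys_snoc: "valleys (ws @ [w, x, y]) = valleys (ws @ [w, x]) + of_bool (x < w \<and> x < y)"
proof -
  have "(ws @ [w, x, y]) ! Suc (length ws) = x" "(ws @ [w, x, y]) ! Suc (Suc (length ws)) = y"
    by (simp_all add: nth_append)
  moreover have "(\<Sum>i<length ws. of_bool ((ws @ [w, x, y]) ! Suc i < (ws @ [w, x, y]) ! i \<and>
       (ws @ [w, x, y]) ! Suc i < (ws @ [w, x, y]) ! Suc (Suc i))) =
     (\<Sum>i<length ws. of_bool ((ws @ [w, x]) ! Suc i < (ws @ [w, x]) ! i \<and>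
       (ws @ [w, x]) ! Suc i < (ws @ [w, x]) ! Suc (Suc i)) :: nat)"
    by (intro sum.cong refl) (auto simp: nth_append nth_Cons' numeral_2_eq_2 less_Suc_eq)
  ultimately show ?thesis by (simp add: valleys_def)
qed

text \<open>
  The series \<open>H\<close> for both kinds of last label together has a product form. The split of \<open>H\<close> into
  top and bottom labels depends on the last step: after an ascent the two parts are \<open>p * H\<close> and
  \<open>(1 - p) * H\<close>, because either kind of label then admits the same predecessors.
  After a descent the top part requires a new shelf, and \<open>F * Q = p * x * H\<close>. Then an ascent
  following a descent replaces the factor \<open>Q\<close> of the descent by \<open>x\<close>. The last conjunct
  carries this information through the induction.
\<close>

lemma last_label_gf_closed_form:
  fixes p :: real
  assumes "distinct (x # zs)" "p > 0" "p < 1"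
  defines "P \<equiv> fps_const p + fps_const (1 - p) * fps_X" and "Q \<equiv> fps_const (1 - p) + fps_const p * fps_X"
  defines "F \<equiv> fst (last_label_gf p (x # zs))" and "H \<equiv> fst (last_label_gf p (x # zs)) + snd (last_label_gf p (x # zs))"
  shows "\<exists>a d v. H = fps_X * geo ^ length (x # zs) * (fps_X ^ v * P ^ a * Q ^ d) \<and>
     a + v = ascents (rev (x # zs)) \<and> d + v = descents (rev (x # zs)) \<and> v = valleys (rev (x # zs)) \<and>
     (if zs = [] \<or> hd zs < x then F = fps_const p * H else d > 0 \<and> F * Q = fps_const p * fps_X * H)"
  using assms(1) unfolding F_def H_def
proof (induction zs arbitrary: x)
  case Nil
  have "fps_const p * (fps_X * geo) + fps_const (1 - p) * (fps_X * geo) = fps_X * geo"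
    by (simp flip: fps_const_add distrib_right)
  then show ?case by (auto simp: ascents_def descents_def valleys_def intro!: exI[of _ 0])
next
  case (Cons w zs)
  define F where "F = fst (last_label_gf p (w # zs))"
  define G where "G = snd (last_label_gf p (w # zs))"
  define H where "H = F + G"
  define L where "L = fps_X * (geo * H)"
  define \<sigma> where "\<sigma> = geo"
  have \<sigma>: "\<sigma> = 1 + fps_X * \<sigma>" unfolding \<sigma>_def by (rule geo_X)
  have X\<sigma>: "fps_X * \<sigma> = \<sigma> - 1" using \<sigma> by (metis add_diff_cancel_left')
  \<comment> \<open>the only ring identity behind the recursion, for the factors P and Q at once\<close>
  have mix: "\<sigma> * (a + b * fps_X) = a * \<sigma> + b * (fps_X * \<sigma>)" for a b
    by (simp add: algebra_simps)
  define u where "u = fps_const p"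
  define v where "v = fps_const (1 - p)"
  have uv: "v = 1 - u" by (simp add: u_def v_def fps_const_sub[symmetric] del: fps_const_sub)
  have Q0: "Q \<noteq> 0"
  proof -
    have "fps_nth Q 0 \<noteq> 0" using assms by (simp add: Q_def)
    then show ?thesis by (metis fps_zero_nth)
  qed
  define N where "N = length (w # zs)"
  obtain a d k where IH: "H = fps_X * \<sigma> ^ N * (fps_X ^ k * P ^ a * Q ^ d)"
     "a + k = ascents (rev (w # zs))" "d + k = descents (rev (w # zs))" "k = valleys (rev (w # zs))"
     "if zs = [] \<or> hd zs < w then F = u * H else d > 0 \<and> F * Q = u * fps_X * H"
    using Cons.IH[of w] Cons.prems unfolding F_def G_def H_def N_def \<sigma>_def u_def by auto
  have asc: "ascents (rev (x # w # zs)) = ascents (rev (w # zs)) + of_bool (w < x)"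
    using ascents_snoc[of "rev zs" w x] by simp
  have desc: "descents (rev (x # w # zs)) = descents (rev (w # zs)) + of_bool (x < w)"
    using descents_snoc[of "rev zs" w x] by simp
  have val: "valleys (rev (x # w # zs)) = valleys (rev (w # zs)) + of_bool (zs \<noteq> [] \<and> w < hd zs \<and> w < x)"
  proof (cases zs)
    case Nil then show ?thesis by (simp add: valleys_def)
  next
    case (Cons z zs') then show ?thesis using valleys_snoc[of "rev zs'" z w x] by simp
  qed
  have P: "P = u + v * fps_X" and Q: "Q = v + u * fps_X" by (simp_all add: P_def Q_def u_def v_def)
  let ?F' = "fst (last_label_gf p (x # w # zs))" and ?G' = "snd (last_label_gf p (x # w # zs))"
  have concl: ?case
    if "?F' + ?G' = fps_X * \<sigma> ^ Suc N * (fps_X ^ k * P ^ a * Q ^ d)"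
      "a + k = ascents (rev (x # w # zs))" "d + k = descents (rev (x # w # zs))"
      "k = valleys (rev (x # w # zs))"
      "if w < x then ?F' = u * (?F' + ?G') else d > 0 \<and> ?F' * Q = u * fps_X * (?F' + ?G')" for a d k
    by (rule exI[of _ a], rule exI[of _ d], rule exI[of _ k], intro conjI)
      (use that in \<open>simp_all only: N_def \<sigma>_def u_def length_Cons list.sel list.distinct simp_thms\<close>)
  consider "w < x" "zs = [] \<or> hd zs < w" | "w < x" "zs \<noteq> []" "w < hd zs" | "x < w"
    using Cons.prems by (cases zs) (auto simp: neq_iff)
  then show ?case
  proof cases
    case 1
    have F': "?F' = u * (L + F)" "?G' = v * (L + F)"
      using 1 by (simp_all add: Let_def case_prod_unfold F_def G_def L_def H_def u_def v_def)
    have "F = u * H" using IH(5) 1 by simp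
    have "?F' + ?G' = L + F" unfolding F' uv by (simp add: algebra_simps)
    also have "\<dots> = (fps_X * \<sigma> + u) * H" unfolding L_def \<open>F = u * H\<close> \<sigma>_def by (simp add: algebra_simps)
    also have "fps_X * \<sigma> + u = \<sigma> * P" unfolding P mix uv X\<sigma> by (simp add: algebra_simps)
    finally have H': "?F' + ?G' = \<sigma> * P * H" .
    have "?F' = u * (?F' + ?G')" unfolding F' uv by (simp add: algebra_simps)
    then have last: "if w < x then ?F' = u * (?F' + ?G') else d > 0 \<and> ?F' * Q = u * fps_X * (?F' + ?G')"
      using 1 by metis
    show ?thesis
      by (rule concl[of k "Suc a" d, OF _ _ _ _ last], unfold H' asc desc val IH(1))
        (use IH(2-4) 1 in \<open>auto simp: mult_ac\<close>)
  next
    case 2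
    have F': "?F' = u * (L + F)" "?G' = v * (L + F)"
      using 2 by (simp_all add: Let_def case_prod_unfold F_def G_def L_def H_def u_def v_def)
    have F: "F * Q = u * fps_X * H" and "d > 0" using IH(5) 2 by auto
    then obtain d' where d': "d = Suc d'" by (cases d) auto
    have "?F' + ?G' = L + F" unfolding F' uv by (simp add: algebra_simps)
    then have "(?F' + ?G') * Q = fps_X * \<sigma> * Q * H + F * Q"
      unfolding L_def \<sigma>_def by (simp add: algebra_simps)
    also have "\<dots> = fps_X * (\<sigma> * Q + u) * H" unfolding F by (simp add: algebra_simps)
    also have "\<sigma> * Q + u = \<sigma>" unfolding Q mix uv X\<sigma> by (simp add: algebra_simps)
    also have "fps_X * \<sigma> * H = (fps_X * \<sigma> * (fps_X * \<sigma> ^ N * (fps_X ^ k * P ^ a * Q ^ d'))) * Q"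
      unfolding IH(1) d' by (simp add: mult_ac)
    finally have H': "?F' + ?G' = fps_X * \<sigma> * (fps_X * \<sigma> ^ N * (fps_X ^ k * P ^ a * Q ^ d'))"
      using Q0 by simp
    have "?F' = u * (?F' + ?G')" unfolding F' uv by (simp add: algebra_simps)
    then have last: "if w < x then ?F' = u * (?F' + ?G') else d' > 0 \<and> ?F' * Q = u * fps_X * (?F' + ?G')"
      using 2 by metis
    show ?thesis
      by (rule concl[of "Suc k" a d', OF _ _ _ _ last], unfold H' asc desc val)
        (use IH(2-4) 2 d' in \<open>auto simp: mult_ac\<close>)
  next
    case 3
    have F': "?F' = u * L" "?G' = v * (L + H)"
      using 3 by (simp_all add: Let_def case_prod_unfold F_def G_def L_def H_def u_def v_def add.assoc)
    have "?F' + ?G' = (fps_X * \<sigma> + v) * H" unfolding F' uv L_def \<sigma>_def by (simp add: algebra_simps)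
    also have "fps_X * \<sigma> + v = \<sigma> * Q" unfolding Q mix uv X\<sigma> by (simp add: algebra_simps)
    finally have H': "?F' + ?G' = \<sigma> * Q * H" .
    have "?F' * Q = u * fps_X * (?F' + ?G')" unfolding H' unfolding F' L_def \<sigma>_def by (simp add: mult_ac)
    then have last: "if w < x then ?F' = u * (?F' + ?G') else Suc d > 0 \<and> ?F' * Q = u * fps_X * (?F' + ?G')"
      using 3 by auto
    show ?thesis
      by (rule concl[of k a "Suc d", OF _ _ _ _ last], unfold H' asc desc val IH(1))
        (use IH(2-4) 3 in \<open>auto simp: mult_ac\<close>)
  qed
qed

section \<open>Asymptotics of the coefficient functional\<close>

text \<open>
  The bound \<open>100 * n \<le> m\<close> keeps \<open>\<rho> = n / m\<close> so small that all logarithms and exponentials below are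
  in the range of their Taylor estimates.
\<close>

locale many_shelves =
  fixes n m :: nat
  assumes n_pos: "n > 0" and m_large: "100 * n \<le> m"
begin

definition \<rho> :: real where "\<rho> = real n / real m"

text \<open>
  For \<open>p = 1\<close> all piles are increasing, and this is the density, with respect to the uniform
  measure, of the shuffle at a permutation with \<open>t\<close> descents (see \<open>rising_density_eq_choose\<close>).
\<close>

definition rising_density :: "nat \<Rightarrow> real" where
  "rising_density t = (\<Prod>j<n. 1 + (real j - real t) / real m)"

text \<open>
  Extraction of the coefficient of \<open>x ^ m\<close>, normalised to a density (see \<open>Lam_eq_fps_nth\<close>). It is defined
  by its values on the monomials because the estimates for \<open>rising_density\<close> then carry
  over to all polynomials with nonnegative coefficients.
\<close>

definition Lam :: "real poly \<Rightarrow> real" where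
  "Lam R = (\<Sum>t\<le>degree R. coeff R t * rising_density t)"

definition nonneg_poly :: "nat \<Rightarrow> real poly \<Rightarrow> bool" where
  "nonneg_poly k R \<longleftrightarrow> (\<forall>t. coeff R t \<ge> 0) \<and> R \<noteq> 0 \<and> degree R \<le> k"

lemma m_pos: "m > 0" using n_pos m_large by simp

lemma rho_pos: "\<rho> > 0" using n_pos m_pos by (simp add: \<rho>_def)

lemma rho_le: "\<rho> \<le> 1 / 100"
  using m_pos m_large by (simp add: \<rho>_def field_simps flip: of_nat_mult)

lemma rising_density_pos: "t \<le> n \<Longrightarrow> rising_density t > 0"
  unfolding rising_density_def using m_pos m_large by (intro prod_pos) (auto simp: field_simps)

text \<open>
  Up to the factor \<open>m ^ n\<close>, the values at \<open>t\<close> and \<open>Suc t\<close> are products of \<open>n\<close> consecutive integers, and the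
  two ranges are one step apart.
\<close>

lemma rising_density_Suc: "(real m + real n - 1 - real t) * rising_density (Suc t) = (real m - 1 - real t) * rising_density t"
proof -
  define x where "x = real m - real t"
  have rising_density: "rising_density s = (\<Prod>j<n. real m - real s + real j) / real m ^ n" for s
  proof -
    have "1 + (real j - real s) / real m = (real m - real s + real j) / real m" for j
      using m_pos by (simp add: field_simps)
    then show ?thesis by (simp add: rising_density_def prod_dividef)
  qed
  have "(x - 1 + real n) * (\<Prod>j<n. x - 1 + real j) = (\<Prod>j<Suc n. x - 1 + real j)"
    by simp
  also have "\<dots> = (x - 1) * (\<Prod>j<n. x + real j)"
    unfolding prod.lessThan_Suc_shift by (simp add: algebra_simps)
  finally show ?thesis
    unfolding rising_density using m_pos by (simp add: x_def field_simps)
qed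

lemma rising_density_ratio:
  assumes "t < n"
  shows "(1 - \<rho>) * rising_density t \<le> rising_density (Suc t)" "rising_density (Suc t) \<le> rising_density t / (1 + \<rho>)"
proof -
  define M where "M = real m + real n - 1 - real t"
  have M: "real m \<le> M" "M \<le> real m + real n" using assms by (auto simp: M_def)
  have m: "real m > 0" "real n > 0" using m_pos n_pos by auto
  have gt: "rising_density t > 0" using rising_density_pos assms by simp
  have eq: "rising_density (Suc t) = (1 - real n / M) * rising_density t"
    using rising_density_Suc[of t] M m by (simp add: M_def field_simps)
  have "real n / M \<le> \<rho>" unfolding \<rho>_def using M m by (intro divide_left_mono) auto
  then show "(1 - \<rho>) * rising_density t \<le> rising_density (Suc t)" unfolding eq using gt by (intro mult_right_mono) auto
  have "real n / (real m + real n) \<le> real n / M" using M m by (intro divide_left_mono) auto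
  moreover have "1 / (1 + \<rho>) = 1 - real n / (real m + real n)"
    using m by (simp add: \<rho>_def field_simps)
  ultimately have "1 - real n / M \<le> 1 / (1 + \<rho>)" by simp
  then have "(1 - real n / M) * rising_density t \<le> 1 / (1 + \<rho>) * rising_density t" using gt by (intro mult_right_mono) auto
  then show "rising_density (Suc t) \<le> rising_density t / (1 + \<rho>)" unfolding eq by simp
qed

text \<open>
  The second difference has a closed form,
  \<open>n * (n - 1) / (M * (M + n - 1))\<close> times the middle value with \<open>M = m - 1 - t\<close>. Its relative deviation
  from \<open>\<rho>\<^sup>2\<close> is of order \<open>\<rho> + 1 / n\<close>. This is stronger than what \<open>rising_density_ratio\<close> yields, whose
  errors are themselves of order \<open>\<rho>\<^sup>2\<close>.
\<close>

lemma rising_density_second_difference: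
  assumes "t + 2 \<le> n"
  defines "D \<equiv> rising_density t - 2 * rising_density (Suc t) + rising_density (Suc (Suc t))"
  shows "(\<rho>\<^sup>2 - \<rho>\<^sup>2 / real n - \<rho> ^ 3) * rising_density (Suc t) \<le> D" "D \<le> (\<rho>\<^sup>2 + 2 * \<rho> ^ 3) * rising_density (Suc t)"
proof -
  define M where "M = real m - 1 - real t"
  define N where "N = real n"
  have mn: "real m = 1 + real t + M" by (simp add: M_def)
  have m: "real m > 0" "N \<ge> 2" using m_pos assms(1) by (auto simp: N_def)
  have M: "real m - N \<le> M - 1" "M \<le> real m" "real m \<le> M + N - 1" "M + N - 1 \<le> real m + N"
    using assms(1) by (auto simp: M_def N_def)
  have r: "\<rho> * real m = N" using m by (simp add: \<rho>_def N_def)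
  have r1: "0 < \<rho>" "\<rho> \<le> 1/100" using rho_pos rho_le by auto
  have M0: "M > 0" "M + N - 1 > 0" using M m m_large by (auto simp: N_def)
  have gS: "rising_density (Suc t) > 0" using rising_density_pos assms(1) by simp
  have "(M + N) * rising_density (Suc t) = M * rising_density t" "(M + N - 1) * rising_density (Suc (Suc t)) = (M - 1) * rising_density (Suc t)"
    using rising_density_Suc[of t] rising_density_Suc[of "Suc t"] by (simp_all add: M_def N_def algebra_simps)
  then have "rising_density t = (M + N) / M * rising_density (Suc t)" "rising_density (Suc (Suc t)) = (M - 1) / (M + N - 1) * rising_density (Suc t)"
    using M0 by (simp_all add: field_simps)
  then have "D = ((M + N) / M - 2 + (M - 1) / (M + N - 1)) * rising_density (Suc t)"
    by (simp add: D_def algebra_simps)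
  also have "(M + N) / M - 2 + (M - 1) / (M + N - 1) = N * (N - 1) / (M * (M + N - 1))"
    using M0 by (simp add: field_simps)
  finally have D: "D = N * (N - 1) / (M * (M + N - 1)) * rising_density (Suc t)" .
  have "N * (N - 1) / (M * (M + N - 1)) \<ge> N * (N - 1) / (real m * (real m + N))"
    using M M0 m by (intro divide_left_mono mult_mono mult_pos_pos) auto
  moreover have "N * (N - 1) / (real m * (real m + N)) = \<rho>\<^sup>2 * (1 - 1 / N) / (1 + \<rho>)"
  proof -
    have "N * (N - 1) / (c * (c + N)) = (N / c)\<^sup>2 * (1 - 1 / N) / (1 + N / c)" if "c > 0" for c :: real
      using that m by (simp add: divide_simps power2_eq_square)
    then show ?thesis using m by (simp add: \<rho>_def N_def)
  qed
  moreover have "\<rho>\<^sup>2 * (1 - 1 / N) / (1 + \<rho>) \<ge> \<rho>\<^sup>2 - \<rho>\<^sup>2 / N - \<rho> ^ 3"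
  proof -
    have "(1 - 1 / N - \<rho>) * (1 + \<rho>) \<le> 1 - 1 / N"
    proof -
      have "(1 - 1 / N - \<rho>) * (1 + \<rho>) = 1 - 1 / N - \<rho> / N - \<rho> * \<rho>"
        by (simp add: algebra_simps)
      moreover have "\<rho> / N \<ge> 0" "\<rho> * \<rho> \<ge> 0" using r1 m by auto
      ultimately show ?thesis by linarith
    qed
    then have "1 - 1 / N - \<rho> \<le> (1 - 1 / N) / (1 + \<rho>)"
      using r1 by (simp add: pos_le_divide_eq)
    then have "\<rho>\<^sup>2 * (1 - 1 / N - \<rho>) \<le> \<rho>\<^sup>2 * ((1 - 1 / N) / (1 + \<rho>))"
      by (intro mult_left_mono) auto
    then show ?thesis by (simp add: algebra_simps power2_eq_square power3_eq_cube)
  qed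
  ultimately have "\<rho>\<^sup>2 - \<rho>\<^sup>2 / N - \<rho> ^ 3 \<le> N * (N - 1) / (M * (M + N - 1))" by linarith
  then show "(\<rho>\<^sup>2 - \<rho>\<^sup>2 / real n - \<rho> ^ 3) * rising_density (Suc t) \<le> D"
    unfolding D N_def using gS by (intro mult_right_mono) auto
  have mN: "real m - N > 0" using m m_large by (auto simp: N_def)
  have "N * (N - 1) / (M * (M + N - 1)) \<le> N * N / ((real m - N) * real m)"
    using M M0 m mN by (intro frac_le mult_mono mult_pos_pos) auto
  also have "\<dots> = \<rho>\<^sup>2 / (1 - \<rho>)"
    using m r1 mN unfolding r[symmetric] by (simp add: field_simps power2_eq_square)
  also have "\<dots> \<le> \<rho>\<^sup>2 * (1 + 2 * \<rho>)"
  proof -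
    have "1 \<le> (1 + 2 * \<rho>) * (1 - \<rho>)" using r1 by (auto simp: algebra_simps) (simp add: power2_eq_square)?
    then have "1 / (1 - \<rho>) \<le> 1 + 2 * \<rho>" using r1 by (simp add: pos_divide_le_eq)
    then have "\<rho>\<^sup>2 * (1 / (1 - \<rho>)) \<le> \<rho>\<^sup>2 * (1 + 2 * \<rho>)" by (intro mult_left_mono) auto
    then show ?thesis by simp
  qed
  also have "\<dots> = \<rho>\<^sup>2 + 2 * \<rho> ^ 3" by (simp add: algebra_simps power2_eq_square power3_eq_cube)
  finally show "D \<le> (\<rho>\<^sup>2 + 2 * \<rho> ^ 3) * rising_density (Suc t)"
    unfolding D using gS by (intro mult_right_mono) auto
qed

lemma Lam_eq: "degree R \<le> N \<Longrightarrow> Lam R = (\<Sum>t\<le>N. coeff R t * rising_density t)"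
  unfolding Lam_def by (intro sum.mono_neutral_left) (auto simp: coeff_eq_0)

lemma Lam_add: "Lam (R + S) = Lam R + Lam S"
proof -
  define N where "N = max (degree R) (degree S)"
  have "degree (R + S) \<le> N" unfolding N_def by (rule degree_add_le_max)
  then show ?thesis
    using Lam_eq[of R N] Lam_eq[of S N] Lam_eq[of "R + S" N]
    by (simp add: N_def distrib_right sum.distrib)
qed

lemma Lam_smult: "Lam (smult c R) = c * Lam R"
  using Lam_eq[of "smult c R" "degree R"] by (simp add: Lam_def sum_distrib_left mult_ac)

lemma Lam_X: "degree R \<le> N \<Longrightarrow> Lam ([:0, 1:] * R) = (\<Sum>t\<le>N. coeff R t * rising_density (Suc t))"
  by (subst Lam_eq[of _ "Suc N"]) (auto simp: sum.atMost_Suc_shift degree_pCons_eq_if simp del: sum.atMost_Suc)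

lemma Lam_pos: "nonneg_poly k R \<Longrightarrow> k \<le> n \<Longrightarrow> Lam R > 0"
  unfolding Lam_def nonneg_poly_def
  by (intro sum_pos2[of _ "degree R"] mult_pos_pos mult_nonneg_nonneg less_imp_le[OF rising_density_pos] rising_density_pos)
    (auto simp: less_le)

lemma nonneg_poly_linear:
  assumes "nonneg_poly k R" "0 \<le> c" "c \<le> 1"
  shows "nonneg_poly (Suc k) ([:1 - c, c:] * R)"
proof -
  have "coeff ([:1 - c, c:] * R) t \<ge> 0" for t
    using assms by (auto simp: nonneg_poly_def coeff_pCons intro!: add_nonneg_nonneg mult_nonneg_nonneg split: nat.split)
  moreover have "degree ([:1 - c, c:] * R) \<le> Suc k"
    using degree_mult_le[of "[:1 - c, c:]" R] assms(1) by (auto simp: nonneg_poly_def split: if_splits)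
  moreover have "[:1 - c, c:] * R \<noteq> 0" using assms(1) by (auto simp: nonneg_poly_def simp del: mult_pCons_left)
  ultimately show ?thesis by (simp only: nonneg_poly_def) auto
qed

lemma nonneg_poly_linear_power:
  "nonneg_poly k R \<Longrightarrow> 0 \<le> c \<Longrightarrow> c \<le> 1 \<Longrightarrow> nonneg_poly (k + j) ([:1 - c, c:] ^ j * R)"
  by (induction j) (auto simp: mult.assoc simp del: mult_pCons_left intro!: nonneg_poly_linear)

lemma nonneg_poly_X_power: "nonneg_poly k R \<Longrightarrow> nonneg_poly (k + j) ([:0, 1:] ^ j * R)"
  using nonneg_poly_linear_power[of k R 1 j] by simp

lemma nonneg_poly_1: "nonneg_poly 0 1" by (auto simp: nonneg_poly_def)

lemma ln_Lam_linear:
  assumes "nonneg_poly k R" "k < n" "0 \<le> c" "c \<le> 1"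
  shows "\<bar>ln (Lam ([:1 - c, c:] * R)) - ln (Lam R) + c * \<rho>\<bar> \<le> 2 * \<rho>\<^sup>2"
proof -
  have L: "Lam R > 0" using Lam_pos assms by simp
  have r: "0 < \<rho>" "\<rho> \<le> 1/100" using rho_pos rho_le by auto
  have c\<rho>: "c * \<rho> \<le> \<rho>" "0 \<le> c * \<rho>" using r assms mult_left_le_one_le[of \<rho> c] by auto
  have coeff: "coeff R t \<ge> 0" "degree R \<le> k" for t using assms by (auto simp: nonneg_poly_def)
  have "[:1 - c, c:] * R = smult (1 - c) R + smult c ([:0, 1:] * R)" by simp
  then have eq: "Lam ([:1 - c, c:] * R) = (1 - c) * Lam R + c * Lam ([:0, 1:] * R)"
    by (simp only: Lam_add Lam_smult)
  have "(1 - \<rho>) * Lam R \<le> Lam ([:0, 1:] * R)"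
    unfolding Lam_X[OF coeff(2)] Lam_eq[OF coeff(2)] sum_distrib_left
  proof (intro sum_mono)
    fix t assume "t \<in> {..k}"
    then show "(1 - \<rho>) * (coeff R t * rising_density t) \<le> coeff R t * rising_density (Suc t)"
      using mult_left_mono[OF rising_density_ratio(1)[of t] coeff(1)[of t]] assms by (simp add: mult_ac)
  qed
  then have "c * ((1 - \<rho>) * Lam R) \<le> c * Lam ([:0, 1:] * R)"
    using assms by (intro mult_left_mono) auto
  then have lower: "(1 - c * \<rho>) * Lam R \<le> Lam ([:1 - c, c:] * R)"
    unfolding eq by (simp add: algebra_simps)
  have "Lam ([:0, 1:] * R) \<le> Lam R / (1 + \<rho>)"
    unfolding Lam_X[OF coeff(2)] Lam_eq[OF coeff(2)] sum_divide_distrib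
  proof (intro sum_mono)
    fix t assume "t \<in> {..k}"
    then show "coeff R t * rising_density (Suc t) \<le> coeff R t * rising_density t / (1 + \<rho>)"
      using mult_left_mono[OF rising_density_ratio(2)[of t] coeff(1)[of t]] assms by (simp add: mult_ac)
  qed
  then have "c * Lam ([:0, 1:] * R) \<le> c * (Lam R / (1 + \<rho>))"
    using assms by (intro mult_left_mono) auto
  moreover have "1 / (1 + \<rho>) \<le> 1 - \<rho> + \<rho>\<^sup>2"
    using r by (simp add: divide_simps) (simp add: algebra_simps power2_eq_square)
  then have "c * (Lam R / (1 + \<rho>)) \<le> c * ((1 - \<rho> + \<rho>\<^sup>2) * Lam R)"
    using assms L mult_right_mono[of "1 / (1 + \<rho>)" "1 - \<rho> + \<rho>\<^sup>2" "Lam R"]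
    by (intro mult_left_mono) auto
  ultimately have upper: "Lam ([:1 - c, c:] * R) \<le> (1 - c * \<rho> + c * \<rho>\<^sup>2) * Lam R"
    unfolding eq by (simp add: algebra_simps)
  have pos: "1 - c * \<rho> > 0" "1 - c * \<rho> + c * \<rho>\<^sup>2 > 0"
  proof -
    show "1 - c * \<rho> > 0" using c\<rho> r by linarith
    moreover have "c * \<rho>\<^sup>2 \<ge> 0" using assms by simp
    ultimately show "1 - c * \<rho> + c * \<rho>\<^sup>2 > 0" by linarith
  qed
  have Lpos: "Lam ([:1 - c, c:] * R) > 0"
    using lower mult_pos_pos[OF pos(1) L] by linarith
  have "ln (1 - c * \<rho>) + ln (Lam R) \<le> ln (Lam ([:1 - c, c:] * R))"
    using lower pos L Lpos by (simp flip: ln_mult_pos)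
  moreover have "- (c * \<rho>) - 2 * (c * \<rho>)\<^sup>2 \<le> ln (1 - c * \<rho>)"
    using c\<rho> r by (intro ln_one_minus_pos_lower_bound) linarith+
  moreover have "(c * \<rho>)\<^sup>2 \<le> \<rho>\<^sup>2" using c\<rho> by (intro power_mono) auto
  moreover have "ln (Lam ([:1 - c, c:] * R)) \<le> ln (1 - c * \<rho> + c * \<rho>\<^sup>2) + ln (Lam R)"
    using upper pos L Lpos by (simp flip: ln_mult_pos)
  moreover have "ln (1 - c * \<rho> + c * \<rho>\<^sup>2) \<le> - c * \<rho> + c * \<rho>\<^sup>2"
    using ln_le_minus_one[OF pos(2)] by simp
  moreover have "c * \<rho>\<^sup>2 \<le> \<rho>\<^sup>2" using assms by (intro mult_left_le_one_le) auto
  moreover have "\<rho>\<^sup>2 \<ge> 0" by simp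
  ultimately show ?thesis by (simp only: abs_le_iff) linarith
qed

lemma ln_Lam_linear_power:
  assumes "nonneg_poly k R" "k + j \<le> n" "0 \<le> c" "c \<le> 1"
  shows "\<bar>ln (Lam ([:1 - c, c:] ^ j * R)) - ln (Lam R) + real j * (c * \<rho>)\<bar> \<le> real j * (2 * \<rho>\<^sup>2)"
  using assms(2)
proof (induction j)
  case 0 then show ?case by simp
next
  case (Suc j)
  have "\<bar>ln (Lam ([:1 - c, c:] * ([:1 - c, c:] ^ j * R))) - ln (Lam ([:1 - c, c:] ^ j * R)) + c * \<rho>\<bar> \<le> 2 * \<rho>\<^sup>2"
    using Suc.prems assms by (intro ln_Lam_linear[of "k + j"] nonneg_poly_linear_power) auto
  moreover have "[:1 - c, c:] ^ Suc j * R = [:1 - c, c:] * ([:1 - c, c:] ^ j * R)"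
    by (simp only: power_Suc mult.assoc)
  moreover have "real (Suc j) * x = real j * x + x" for x :: real by (simp add: algebra_simps)
  ultimately show ?case using Suc by (simp only:) linarith
qed

lemma ln_Lam_X_power:
  assumes "nonneg_poly k R" "k + j \<le> n"
  shows "\<bar>ln (Lam ([:0, 1:] ^ j * R)) - ln (Lam R) + real j * \<rho>\<bar> \<le> real j * (2 * \<rho>\<^sup>2)"
  using ln_Lam_linear_power[OF assms, of 1] by simp

text \<open>
  A matched pair of an ascent and a descent contributes \<open>x + p * (1 - p) * (1 - x)\<^sup>2\<close>, and \<open>(1 - x)\<^sup>2\<close> acts as a
  second difference of \<open>rising_density\<close>. The error per pair is of order \<open>\<rho>\<^sup>2 / n + \<rho> ^ 3\<close>, so it
  remains small after summation over \<open>n\<close> pairs.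
\<close>

lemma ln_Lam_pair:
  assumes "nonneg_poly k S" "k + 2 \<le> n" "0 \<le> p" "p \<le> 1"
  shows "\<bar>ln (Lam ([:p, 1 - p:] * [:1 - p, p:] * S)) - ln (Lam ([:0, 1:] * S)) - p * (1 - p) * \<rho>\<^sup>2\<bar>
    \<le> \<rho>\<^sup>2 / real n + 5 * \<rho> ^ 3"
proof -
  define w where "w = p * (1 - p)"
  have "0 \<le> w" using assms by (simp add: w_def)
  moreover have "w \<le> 1" unfolding w_def using assms mult_le_one[of p "1 - p"] by simp
  ultimately have w: "0 \<le> w" "w \<le> 1" by auto
  have r: "0 < \<rho>" "\<rho> \<le> 1/100" using rho_pos rho_le by auto
  have coeff: "coeff S t \<ge> 0" "degree S \<le> k" for t using assms by (auto simp: nonneg_poly_def)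
  have degX: "degree ([:0, 1:] * S) \<le> Suc k" using coeff by (auto simp: degree_pCons_eq_if)
  have LX: "Lam ([:0, 1:] * S) > 0"
    using Lam_pos[of "k + 1" "[:0, 1:] * S"] nonneg_poly_X_power[OF assms(1), of 1] assms by simp
  define D where "D = Lam S - 2 * Lam ([:0, 1:] * S) + Lam ([:0, 1:] * ([:0, 1:] * S))"
  have "[:p, 1 - p:] * [:1 - p, p:] * S =
      [:0, 1:] * S + smult w (S + smult (- 2) ([:0, 1:] * S) + [:0, 1:] * ([:0, 1:] * S))"
  proof -
    have "[:p, 1 - p:] * [:1 - p, p:] = [:0, 1:] + smult w ([:1:] + smult (- 2) [:0, 1:] + [:0, 1:] * [:0, 1:])"
      by (simp add: w_def algebra_simps)
    then show ?thesis by (simp only: distrib_right mult_smult_left mult.assoc smult_add_right) simp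
  qed
  then have eq: "Lam ([:p, 1 - p:] * [:1 - p, p:] * S) = Lam ([:0, 1:] * S) + w * D"
    by (simp only: Lam_add Lam_smult D_def) simp
  have D: "D = (\<Sum>t\<le>k. coeff S t * (rising_density t - 2 * rising_density (Suc t) + rising_density (Suc (Suc t))))"
    unfolding D_def Lam_X[OF degX] Lam_X[OF coeff(2)] Lam_eq[OF coeff(2)]
    by (simp add: sum.atMost_Suc_shift algebra_simps sum.distrib sum_subtractf sum_distrib_left del: sum.atMost_Suc)
  have D1: "(\<rho>\<^sup>2 - \<rho>\<^sup>2 / real n - \<rho> ^ 3) * Lam ([:0, 1:] * S) \<le> D"
    unfolding D Lam_X[OF coeff(2)] sum_distrib_left
  proof (intro sum_mono)
    fix t assume "t \<in> {..k}"
    then show "(\<rho>\<^sup>2 - \<rho>\<^sup>2 / real n - \<rho> ^ 3) * (coeff S t * rising_density (Suc t)) \<le> coeff S t * (rising_density t - 2 * rising_density (Suc t) + rising_density (Suc (Suc t)))"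
      using mult_left_mono[OF rising_density_second_difference(1)[of t] coeff(1)[of t]] assms by (simp add: mult_ac)
  qed
  have D2: "D \<le> (\<rho>\<^sup>2 + 2 * \<rho> ^ 3) * Lam ([:0, 1:] * S)"
    unfolding D Lam_X[OF coeff(2)] sum_distrib_left
  proof (intro sum_mono)
    fix t assume "t \<in> {..k}"
    then show "coeff S t * (rising_density t - 2 * rising_density (Suc t) + rising_density (Suc (Suc t))) \<le> (\<rho>\<^sup>2 + 2 * \<rho> ^ 3) * (coeff S t * rising_density (Suc t))"
      using mult_left_mono[OF rising_density_second_difference(2)[of t] coeff(1)[of t]] assms by (simp add: mult_ac)
  qed
  define x where "x = w * D / Lam ([:0, 1:] * S)"
  have x: "w * (\<rho>\<^sup>2 - \<rho>\<^sup>2 / real n - \<rho> ^ 3) \<le> x" "x \<le> w * (\<rho>\<^sup>2 + 2 * \<rho> ^ 3)"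
    using mult_left_mono[OF D1 w(1)] mult_left_mono[OF D2 w(1)] LX
    by (simp_all add: x_def pos_le_divide_eq pos_divide_le_eq mult_ac)
  have r3: "\<rho> ^ 3 = \<rho>\<^sup>2 * \<rho>" by (simp add: power2_eq_square power3_eq_cube)
  have n2: "real n \<ge> 2" using assms(2) by simp
  have "\<rho>\<^sup>2 / real n \<le> \<rho>\<^sup>2 / 2" using n2 by (intro divide_left_mono) auto
  moreover have "\<rho> ^ 3 \<le> \<rho>\<^sup>2 * (1/100)" unfolding r3 using r by (intro mult_left_mono) auto
  ultimately have "\<rho>\<^sup>2 - \<rho>\<^sup>2 / real n - \<rho> ^ 3 \<ge> 0" "\<rho>\<^sup>2 + 2 * \<rho> ^ 3 \<le> 2 * \<rho>\<^sup>2"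
    using zero_le_power2[of \<rho>] by linarith+
  then have x0: "0 \<le> x" "x \<le> 2 * \<rho>\<^sup>2"
    using order_trans[OF mult_nonneg_nonneg[OF w(1)] x(1)]
      order_trans[OF x(2) order_trans[OF mult_left_le_one_le]] w r by auto
  have "Lam ([:p, 1 - p:] * [:1 - p, p:] * S) = (1 + x) * Lam ([:0, 1:] * S)"
    unfolding eq x_def using LX by (simp add: field_simps)
  then have ln: "ln (Lam ([:p, 1 - p:] * [:1 - p, p:] * S)) - ln (Lam ([:0, 1:] * S)) = ln (1 + x)"
    using x0 LX by (simp add: ln_mult_pos)
  have "\<rho>\<^sup>2 \<le> 1" using r power_mono[of \<rho> 1 2] by simp
  have "\<rho>\<^sup>2 \<le> \<rho> * (1/100)" unfolding power2_eq_square using r by (intro mult_left_mono) auto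
  then have "x \<le> \<rho>" using x0 r by linarith
  then have "x\<^sup>2 \<le> 2 * \<rho>\<^sup>2 * \<rho>" unfolding power2_eq_square[of x] using x0 r by (intro mult_mono) auto
  then have x2: "x\<^sup>2 \<le> 2 * \<rho> ^ 3" by (simp add: r3)
  have l1: "ln (1 + x) \<le> x" "x - x\<^sup>2 \<le> ln (1 + x)"
    using ln_add_one_self_le_self[OF x0(1)] ln_one_plus_pos_lower_bound[OF x0(1)] \<open>x \<le> \<rho>\<close> r by auto
  have w1: "w * (\<rho>\<^sup>2 / real n + \<rho> ^ 3) \<le> \<rho>\<^sup>2 / real n + \<rho> ^ 3" "w * (2 * \<rho> ^ 3) \<le> 2 * \<rho> ^ 3"
    using w r by (auto intro!: mult_left_le_one_le)
  have "x \<le> w * \<rho>\<^sup>2 + w * (2 * \<rho> ^ 3)" "w * \<rho>\<^sup>2 - w * (\<rho>\<^sup>2 / real n + \<rho> ^ 3) \<le> x"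
    using x by (auto simp: algebra_simps)
  moreover have "0 \<le> \<rho> ^ 3" "0 \<le> \<rho>\<^sup>2 / real n" using r by auto
  ultimately show ?thesis
    unfolding ln w_def[symmetric] using l1 w1 x2 by (simp only: abs_le_iff) linarith
qed

lemma nonneg_poly_pair:
  assumes "nonneg_poly k S" "0 \<le> p" "p \<le> 1"
  shows "nonneg_poly (k + 2 * d) (([:p, 1 - p:] * [:1 - p, p:]) ^ d * S)"
proof -
  have "nonneg_poly (k + d + d) ([:1 - (1 - p), 1 - p:] ^ d * ([:1 - p, p:] ^ d * S))"
    using assms by (intro nonneg_poly_linear_power) auto
  moreover have "[:1 - (1 - p), 1 - p:] ^ d * ([:1 - p, p:] ^ d * S) = ([:p, 1 - p:] * [:1 - p, p:]) ^ d * S"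
  proof -
    have "1 - (1 - p) = p" by simp
    then show ?thesis by (simp only: power_mult_distrib mult.assoc)
  qed
  ultimately show ?thesis by (simp only: mult_2 add.assoc)
qed

lemma ln_Lam_pair_power:
  assumes "nonneg_poly k S" "k + 2 * d \<le> n" "0 \<le> p" "p \<le> 1"
  shows "\<bar>ln (Lam (([:p, 1 - p:] * [:1 - p, p:]) ^ d * S)) - ln (Lam ([:0, 1:] ^ d * S))
     - real d * (p * (1 - p) * \<rho>\<^sup>2)\<bar> \<le> real d * (\<rho>\<^sup>2 / real n + 5 * \<rho> ^ 3)"
  using assms(1,2)
proof (induction d arbitrary: k S)
  case 0 then show ?case by simp
next
  case (Suc d)
  let ?Q = "[:p, 1 - p:] * [:1 - p, p:]"
  have "\<bar>ln (Lam (?Q * (?Q ^ d * S))) - ln (Lam ([:0, 1:] * (?Q ^ d * S))) - p * (1 - p) * \<rho>\<^sup>2\<bar>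
    \<le> \<rho>\<^sup>2 / real n + 5 * \<rho> ^ 3"
    using Suc.prems assms by (intro ln_Lam_pair[of "k + 2 * d"] nonneg_poly_pair) auto
  moreover have "\<bar>ln (Lam (?Q ^ d * ([:0, 1:] * S))) - ln (Lam ([:0, 1:] ^ d * ([:0, 1:] * S)))
     - real d * (p * (1 - p) * \<rho>\<^sup>2)\<bar> \<le> real d * (\<rho>\<^sup>2 / real n + 5 * \<rho> ^ 3)"
    using Suc.prems nonneg_poly_X_power[OF Suc.prems(1), of 1] by (intro Suc.IH[of "k + 1"]) auto
  moreover have "?Q ^ Suc d * S = ?Q * (?Q ^ d * S)" "[:0, 1:] ^ Suc d * S = [:0, 1:] ^ d * ([:0, 1:] * S)"
    "[:0, 1:] * (?Q ^ d * S) = ?Q ^ d * ([:0, 1:] * S)"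
    by (simp_all only: power_Suc mult_ac)
  moreover have "real (Suc d) * x = real d * x + x" for x :: real by (simp add: algebra_simps)
  ultimately show ?case by (simp only: abs_le_iff) linarith
qed

lemma Lam_X_power: "Lam ([:0, 1:] ^ t) = rising_density t"
proof -
  have "[:0, 1:] ^ t = monom (1::real) t" by (metis monom_altdef smult_1_left)
  then show ?thesis
    by (simp add: Lam_def degree_monom_eq coeff_monom if_distrib[of "\<lambda>x. x * _"] cong: if_cong)
qed

text \<open>
  The polynomial of a permutation with \<open>v\<close> valleys and, outside the valleys, \<open>a\<close> ascents and \<open>d\<close>
  descents.
\<close>

definition W :: "real \<Rightarrow> nat \<Rightarrow> nat \<Rightarrow> nat \<Rightarrow> real poly" where
  "W p v a d = [:0, 1:] ^ v * ([:p, 1 - p:] ^ a * [:1 - p, p:] ^ d)"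

lemma nonneg_poly_W_mult:
  assumes "nonneg_poly k S" "0 \<le> p" "p \<le> 1"
  shows "nonneg_poly (k + d + a + v) (W p v a d * S)"
proof -
  have "1 - (1 - p) = p" by simp
  then show ?thesis
    using nonneg_poly_X_power[OF nonneg_poly_linear_power[OF nonneg_poly_linear_power[OF assms(1), of p d], of "1 - p" a], of v] assms
    by (simp add: W_def mult.assoc del: mult_pCons_left mult_pCons_right)
qed

lemma nonneg_poly_W: "0 \<le> p \<Longrightarrow> p \<le> 1 \<Longrightarrow> nonneg_poly (d + a + v) (W p v a d)"
  using nonneg_poly_W_mult[OF nonneg_poly_1, of p d a v] by simp

lemma W_add: "W p (v + v') (a + a') (d + d') = W p v a d * W p v' a' d'"
  by (simp only: W_def power_add mult_ac)

lemma ln_Lam_W_mult: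
  assumes "nonneg_poly k S" "k + d + a + v \<le> n" "0 \<le> p" "p \<le> 1"
  shows "\<bar>ln (Lam (W p v a d * S)) - ln (Lam S) + \<rho> * (real v + (1 - p) * real a + p * real d)\<bar>
    \<le> 2 * \<rho>\<^sup>2 * (real v + real a + real d)"
proof -
  define S1 where "S1 = [:1 - p, p:] ^ d * S"
  define S2 where "S2 = [:p, 1 - p:] ^ a * S1"
  have pp: "1 - (1 - p) = p" by simp
  have q: "0 \<le> 1 - p" "1 - p \<le> 1" using assms by auto
  have 1: "nonneg_poly (k + d) S1" unfolding S1_def using assms by (intro nonneg_poly_linear_power) auto
  have 2: "nonneg_poly (k + d + a) S2"
    unfolding S2_def by (rule nonneg_poly_linear_power[OF 1 q, of a, unfolded pp])
  have W: "W p v a d * S = [:0, 1:] ^ v * S2" by (simp only: W_def S2_def S1_def mult.assoc)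
  have "\<bar>ln (Lam S1) - ln (Lam S) + real d * (p * \<rho>)\<bar> \<le> real d * (2 * \<rho>\<^sup>2)"
    unfolding S1_def using assms by (intro ln_Lam_linear_power) auto
  moreover have "\<bar>ln (Lam S2) - ln (Lam S1) + real a * ((1 - p) * \<rho>)\<bar> \<le> real a * (2 * \<rho>\<^sup>2)"
    unfolding S2_def using assms by (intro ln_Lam_linear_power[OF 1 _ q, of a, unfolded pp]) auto
  moreover have "\<bar>ln (Lam (W p v a d * S)) - ln (Lam S2) + real v * \<rho>\<bar> \<le> real v * (2 * \<rho>\<^sup>2)"
    unfolding W using 2 assms by (intro ln_Lam_X_power) auto
  moreover have "\<rho> * (real v + (1 - p) * real a + p * real d) =
    real d * (p * \<rho>) + real a * ((1 - p) * \<rho>) + real v * \<rho>"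
    "2 * \<rho>\<^sup>2 * (real v + real a + real d) = real d * (2 * \<rho>\<^sup>2) + real a * (2 * \<rho>\<^sup>2) + real v * (2 * \<rho>\<^sup>2)"
    by (simp_all add: algebra_simps)
  ultimately show ?thesis by (simp only: abs_le_iff) linarith
qed

text \<open>
  Both polynomials are multiples of \<open>W\<close> at the componentwise minimum of the exponents, so only
  the exponents in which they differ contribute to the error.
\<close>

lemma ln_Lam_W_diff:
  assumes "d + a + v \<le> n" "d' + a' + v' \<le> n" "0 \<le> p" "p \<le> 1"
  shows "\<bar>ln (Lam (W p v' a' d')) - ln (Lam (W p v a d))
       + \<rho> * ((real v' - real v) + (1 - p) * (real a' - real a) + p * (real d' - real d))\<bar>
    \<le> 2 * \<rho>\<^sup>2 * (\<bar>real v' - real v\<bar> + \<bar>real a' - real a\<bar> + \<bar>real d' - real d\<bar>)"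
proof -
  \<comment> \<open>exponents of the greatest common factor of the two products\<close>
  define v0 a0 d0 where "v0 = min v v'" "a0 = min a a'" "d0 = min d d'"
  note defs = this
  define S where "S = W p v0 a0 d0"
  have S: "nonneg_poly (d0 + a0 + v0) S" unfolding S_def using assms by (intro nonneg_poly_W)
  have eq: "W p v a d = W p (v - v0) (a - a0) (d - d0) * S"
    "W p v' a' d' = W p (v' - v0) (a' - a0) (d' - d0) * S"
    unfolding S_def W_add[symmetric] by (simp_all add: defs)
  have "\<bar>ln (Lam (W p v a d)) - ln (Lam S) + \<rho> * (real (v - v0) + (1 - p) * real (a - a0) + p * real (d - d0))\<bar>
    \<le> 2 * \<rho>\<^sup>2 * (real (v - v0) + real (a - a0) + real (d - d0))"
    unfolding eq using assms by (intro ln_Lam_W_mult[OF S]) (auto simp: defs)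
  moreover have "\<bar>ln (Lam (W p v' a' d')) - ln (Lam S) + \<rho> * (real (v' - v0) + (1 - p) * real (a' - a0) + p * real (d' - d0))\<bar>
    \<le> 2 * \<rho>\<^sup>2 * (real (v' - v0) + real (a' - a0) + real (d' - d0))"
    unfolding eq using assms by (intro ln_Lam_W_mult[OF S]) (auto simp: defs)
  moreover have "\<rho> * ((real v' - real v) + (1 - p) * (real a' - real a) + p * (real d' - real d)) =
     \<rho> * (real (v' - v0) + (1 - p) * real (a' - a0) + p * real (d' - d0)) -
     \<rho> * (real (v - v0) + (1 - p) * real (a - a0) + p * real (d - d0))"
  proof -
    have "real (v' - v0) = real v' - real v0" "real (a' - a0) = real a' - real a0" "real (d' - d0) = real d' - real d0"
      "real (v - v0) = real v - real v0" "real (a - a0) = real a - real a0" "real (d - d0) = real d - real d0"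
      by (simp_all add: defs of_nat_diff)
    then show ?thesis by (simp only:) (simp add: algebra_simps)
  qed
  moreover have "2 * \<rho>\<^sup>2 * (\<bar>real v' - real v\<bar> + \<bar>real a' - real a\<bar> + \<bar>real d' - real d\<bar>) =
     2 * \<rho>\<^sup>2 * (real (v - v0) + real (a - a0) + real (d - d0)) + 2 * \<rho>\<^sup>2 * (real (v' - v0) + real (a' - a0) + real (d' - d0))"
  proof -
    have "\<bar>real v' - real v\<bar> = real (v' - v0) + real (v - v0)" "\<bar>real a' - real a\<bar> = real (a' - a0) + real (a - a0)"
      "\<bar>real d' - real d\<bar> = real (d' - d0) + real (d - d0)"
      by (auto simp: defs min_def of_nat_diff)
    moreover have "c * ((x + x1) + (y + y1) + (z + z1)) = c * (x1 + y1 + z1) + c * (x + y + z)"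
      for c x y z x1 y1 z1 :: real by (simp add: algebra_simps)
    ultimately show ?thesis by (simp only:)
  qed
  moreover have "\<bar>A' - A + e\<bar> \<le> b"
    if "\<bar>A - L + e1\<bar> \<le> b1" "\<bar>A' - L + e2\<bar> \<le> b2" "e = e2 - e1" "b = b1 + b2"
    for A A' L e e1 e2 b b1 b2 :: real
    using that by linarith
  ultimately show ?thesis by blast
qed

lemma ln_one_plus_cubic_bound:
  fixes u :: real
  assumes "\<bar>u\<bar> \<le> 1 / 2"
  shows "\<bar>ln (1 + u) - u + u\<^sup>2 / 2\<bar> \<le> 2 * \<bar>u\<bar> ^ 3"
proof -
  define f where "f = (\<lambda>u::real. ln (1 + u) - u + u\<^sup>2 / 2)"
  have f': "DERIV f x :> x\<^sup>2 / (1 + x)" if "\<bar>x\<bar> \<le> 1 / 2" for x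
    unfolding f_def using that
    by (auto intro!: derivative_eq_intros simp: field_simps power2_eq_square)
  have f0: "f 0 = 0" by (simp add: f_def)
  obtain x where x: "\<bar>x\<bar> \<le> \<bar>u\<bar>" "f u = u * (x\<^sup>2 / (1 + x))"
  proof (cases u "0 :: real" rule: linorder_cases)
    case less
    then obtain z where "u < z" "z < 0" "f 0 - f u = (0 - u) * (z\<^sup>2 / (1 + z))"
      using MVT2[of u 0 f "\<lambda>x. x\<^sup>2 / (1 + x)"] f' assms by force
    then show thesis using less f0 by (intro that[of z]) auto
  next
    case equal then show thesis using f0 by (intro that[of 0]) auto
  next
    case greater
    then obtain z where "0 < z" "z < u" "f u - f 0 = (u - 0) * (z\<^sup>2 / (1 + z))"
      using MVT2[of 0 u f "\<lambda>x. x\<^sup>2 / (1 + x)"] f' assms by force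
    then show thesis using greater f0 by (intro that[of z]) auto
  qed
  have "\<bar>f u\<bar> = \<bar>u\<bar> * (x\<^sup>2 / \<bar>1 + x\<bar>)" unfolding x(2) by (simp add: abs_mult)
  also have "x\<^sup>2 / \<bar>1 + x\<bar> \<le> u\<^sup>2 / (1 / 2)"
  proof (intro frac_le)
    show "x\<^sup>2 \<le> u\<^sup>2" using x(1) by (simp add: abs_le_square_iff)
    show "1 / 2 \<le> \<bar>1 + x\<bar>" using x(1) assms by linarith
  qed auto
  finally have "\<bar>f u\<bar> \<le> \<bar>u\<bar> * (2 * u\<^sup>2)" by (simp add: mult_left_mono)
  then show ?thesis by (simp add: f_def power3_eq_cube power2_eq_square)
qed

lemma sum_upto_centered_squares:
  "(\<Sum>j<N. (real j - h)) = real N * (real N - 1) / 2 - real N * h"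
  "(\<Sum>j<N. (real j - h)\<^sup>2) = real N * (real N - 1) * (2 * real N - 1) / 6 - h * real N * (real N - 1) + real N * h\<^sup>2"
  by (induction N) (simp_all add: field_simps power2_eq_square)

text \<open>
  Near the centre \<open>h\<close> of the range of \<open>j\<close> the linear terms of the logarithm cancel, and the quadratic
  ones sum to \<open>- (n ^ 3 / 12) / (2 * m\<^sup>2)\<close>.
\<close>

lemma ln_rising_density_center:
  assumes "h = (n - 1) div 2"
  shows "\<bar>ln (rising_density h) + real n * \<rho>\<^sup>2 / 24\<bar> \<le> 2 * \<rho> + 2 * real n * \<rho> ^ 3"
proof -
  define u where "u = (\<lambda>j. (real j - real h) / real m)"
  have r: "0 < \<rho>" "\<rho> \<le> 1/100" using rho_pos rho_le by auto
  have m: "real m > 0" "real n > 0" using m_pos n_pos by auto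
  have hn: "h < n" using assms n_pos by auto
  have u: "\<bar>u j\<bar> \<le> \<rho>" if "j < n" for j
    unfolding u_def \<rho>_def abs_divide using that hn m by (intro frac_le) auto
  have "ln (rising_density h) = (\<Sum>j<n. ln (1 + u j))"
  proof -
    have "rising_density h = (\<Prod>j<n. 1 + u j)" by (simp add: rising_density_def u_def)
    moreover have "0 < 1 + u j" if "j < n" for j using u[OF that] r by linarith
    ultimately show ?thesis by (simp only:) (rule ln_prod, auto simp: less_le)
  qed
  moreover have "(\<Sum>j<n. u j) = (\<Sum>j<n. real j - real h) / real m"
    by (simp add: u_def sum_divide_distrib)
  moreover have "(\<Sum>j<n. (u j)\<^sup>2) = (\<Sum>j<n. (real j - real h)\<^sup>2) / (real m)\<^sup>2"
    by (simp add: u_def sum_divide_distrib power_divide)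
  moreover have "(\<Sum>j<n. ln (1 + u j)) - (\<Sum>j<n. u j) + (\<Sum>j<n. (u j)\<^sup>2) / 2 =
     (\<Sum>j<n. ln (1 + u j) - u j + (u j)\<^sup>2 / 2)"
    by (simp add: sum.distrib sum_subtractf sum_divide_distrib)
  moreover have "\<bar>\<Sum>j<n. ln (1 + u j) - u j + (u j)\<^sup>2 / 2\<bar> \<le> (\<Sum>j<n. 2 * \<rho> ^ 3)"
  proof (intro order_trans[OF sum_abs] sum_mono)
    fix j assume "j \<in> {..<n}"
    then have "\<bar>ln (1 + u j) - u j + (u j)\<^sup>2 / 2\<bar> \<le> 2 * \<bar>u j\<bar> ^ 3"
      using u[of j] r by (intro ln_one_plus_cubic_bound) auto
    also have "\<dots> \<le> 2 * \<rho> ^ 3" using u[of j] \<open>j \<in> {..<n}\<close> by (intro mult_left_mono power_mono) auto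
    finally show "\<bar>ln (1 + u j) - u j + (u j)\<^sup>2 / 2\<bar> \<le> 2 * \<rho> ^ 3" .
  qed
  moreover have "0 \<le> (\<Sum>j<n. real j - real h) / real m \<and> (\<Sum>j<n. real j - real h) / real m \<le> \<rho>
     \<and> \<bar>(\<Sum>j<n. (real j - real h)\<^sup>2) / (real m)\<^sup>2 - real n * \<rho>\<^sup>2 / 12\<bar> \<le> \<rho>\<^sup>2"
  proof -
    have "n = 2 * h + 1 \<or> n = 2 * h + 2" using assms n_pos by presburger
    then have "real n = 2 * real h + 1 \<or> real n = 2 * real h + 2" by auto
    then have hh: "real h = (real n - 1) / 2 \<or> real h = (real n - 2) / 2" by auto
    define N where "N = real n"
    have N: "N \<ge> 1" using n_pos by (simp add: N_def)
    have "0 \<le> (\<Sum>j<n. real j - real h)" "(\<Sum>j<n. real j - real h) \<le> N"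
      unfolding sum_upto_centered_squares using hh N by (auto simp: N_def[symmetric] algebra_simps)
    then have "0 \<le> (\<Sum>j<n. real j - real h) / real m" "(\<Sum>j<n. real j - real h) / real m \<le> \<rho>"
      using m by (auto simp: \<rho>_def N_def divide_right_mono)
    moreover have "\<bar>(\<Sum>j<n. (real j - real h)\<^sup>2) - N ^ 3 / 12\<bar> \<le> N\<^sup>2"
      unfolding sum_upto_centered_squares N_def[symmetric]
    proof -
      have "N\<^sup>2 \<ge> N" using N by (simp add: power2_eq_square)
      show "\<bar>N * (N - 1) * (2 * N - 1) / 6 - real h * N * (N - 1) + N * (real h)\<^sup>2 - N ^ 3 / 12\<bar> \<le> N\<^sup>2"
        using hh unfolding N_def[symmetric]
      proof (elim disjE)
        assume h: "real h = (N - 1) / 2"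
        have "N * (N - 1) * (2 * N - 1) / 6 - real h * N * (N - 1) + N * (real h)\<^sup>2 - N ^ 3 / 12 = - N / 12"
          unfolding h by (simp add: field_simps power2_eq_square power3_eq_cube)
        then show ?thesis using N \<open>N\<^sup>2 \<ge> N\<close> by simp
      next
        assume h: "real h = (N - 2) / 2"
        have "N * (N - 1) * (2 * N - 1) / 6 - real h * N * (N - 1) + N * (real h)\<^sup>2 - N ^ 3 / 12 = N / 6"
          unfolding h by (simp add: field_simps power2_eq_square power3_eq_cube)
        then show ?thesis using N \<open>N\<^sup>2 \<ge> N\<close> by simp
      qed
    qed
    then have "\<bar>(\<Sum>j<n. (real j - real h)\<^sup>2) - N ^ 3 / 12\<bar> / (real m)\<^sup>2 \<le> N\<^sup>2 / (real m)\<^sup>2"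
      by (intro divide_right_mono) auto
    then have "\<bar>((\<Sum>j<n. (real j - real h)\<^sup>2) - N ^ 3 / 12) / (real m)\<^sup>2\<bar> \<le> \<rho>\<^sup>2"
      by (simp add: \<rho>_def N_def power_divide)
    moreover have "N ^ 3 / 12 / (real m)\<^sup>2 = real n * \<rho>\<^sup>2 / 12"
      by (simp add: N_def \<rho>_def power2_eq_square power3_eq_cube)
    ultimately show ?thesis by (simp add: diff_divide_distrib)
  qed
  moreover have "\<rho>\<^sup>2 \<le> \<rho>" using r by (simp add: power2_eq_square)
  moreover have "0 \<le> real n * \<rho>\<^sup>2" using r by simp
  moreover have "(\<Sum>j<n. 2 * \<rho> ^ 3) = 2 * real n * \<rho> ^ 3" by simp
  moreover have "\<bar>L + x / 24\<bar> \<le> 2 * r + t"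
    if "L = SL" "S1 = s1" "S2 = s2" "SL - S1 + S2 / 2 = E" "\<bar>E\<bar> \<le> T"
      "0 \<le> s1 \<and> s1 \<le> r \<and> \<bar>s2 - x / 12\<bar> \<le> r2" "r2 \<le> r" "0 \<le> x" "T = t"
    for L x r t SL S1 S2 s1 s2 E r2 T :: real
    using that by (elim conjE) linarith
  ultimately show ?thesis by blast
qed

text \<open>
  Match every descent with an ascent and apply \<open>ln_Lam_pair_power\<close>; then remove the \<open>a - d\<close> unmatched
  ascents, each at the price \<open>(1 - p) * \<rho>\<close>. What remains is \<open>x ^ (d + v)\<close>, whose exponent is about
  \<open>(a - d) / 2\<close> below the centre, and this costs \<open>\<rho>\<close> per unit.
\<close>

lemma ln_Lam_W_expansion_aux:
  assumes "a + d + 2 * v + 1 = n" "d \<le> a" "0 \<le> p" "p \<le> 1"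
  shows "\<bar>ln (Lam (W p v a d)) -
      (- real n * \<rho>\<^sup>2 / 24 + (p - 1 / 2) * \<rho> * (real a - real d) + p * (1 - p) * \<rho>\<^sup>2 * real d)\<bar>
    \<le> 4 * \<rho> + 7 * real n * \<rho> ^ 3 + 3 * \<rho>\<^sup>2 * (real a - real d)"
proof -
  define h where "h = (n - 1) div 2"
  \<comment> \<open>the distance of the remaining exponent from the centre, (a - d) / 2 up to rounding\<close>
  define k where "k = h - (d + v)"
  have r: "0 < \<rho>" "\<rho> \<le> 1/100" using rho_pos rho_le by auto
  have hk: "h = k + (d + v)" "2 * k \<le> a - d" "a - d \<le> 2 * k + 1"
    using assms(1,2) by (auto simp: h_def k_def)
  then have k: "real k \<le> (real a - real d) / 2" "(real a - real d) / 2 - 1 / 2 \<le> real k"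
  proof -
    have "d + 2 * k \<le> a" "a \<le> d + 2 * k + 1" using hk assms(2) by auto
    then have "real (d + 2 * k) \<le> real a" "real a \<le> real (d + 2 * k + 1)"
      by (simp_all only: of_nat_le_iff)
    then show "real k \<le> (real a - real d) / 2" "(real a - real d) / 2 - 1 / 2 \<le> real k"
      by (simp_all add: field_simps)
  qed
  have pp: "1 - (1 - p) = p" by simp
  define S where "S = W p v (a - d) 0"
  have S: "nonneg_poly (v + (a - d)) S"
    using nonneg_poly_W[of p 0 "a - d" v] assms by (simp add: S_def add.commute)
  define A where "A = ln (Lam (W p v a d))"
  define B where "B = ln (Lam ([:0, 1:] ^ d * S))"
  define C where "C = ln (Lam ([:0, 1:] ^ (d + v)))"
  define x where "x = real a - real d"
  have A: "\<bar>A - B - real d * (p * (1 - p) * \<rho>\<^sup>2)\<bar> \<le> real d * (\<rho>\<^sup>2 / real n + 5 * \<rho> ^ 3)"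
  proof -
    have "W p v a d = W p (0 + v) (d + (a - d)) (d + 0)" using assms(2) by simp
    also have "\<dots> = W p 0 d d * S" unfolding W_add S_def ..
    also have "W p 0 d d = ([:p, 1 - p:] * [:1 - p, p:]) ^ d"
      by (simp only: W_def power_mult_distrib power_0 mult_1_left)
    finally have "W p v a d = ([:p, 1 - p:] * [:1 - p, p:]) ^ d * S" .
    then show ?thesis
      using ln_Lam_pair_power[OF S, of d p] assms by (simp only: A_def B_def)
  qed
  have nonneg_poly: "nonneg_poly (d + v) ([:0, 1:] ^ (d + v))" using nonneg_poly_X_power[OF nonneg_poly_1, of "d + v"] by simp
  have B: "\<bar>B - C + (\<rho> * x - p * (\<rho> * x))\<bar> \<le> 2 * (\<rho>\<^sup>2 * x)"
  proof -
    have "[:0, 1:] ^ d * S = W p 0 (a - d) 0 * [:0, 1:] ^ (d + v)"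
      by (simp only: S_def W_def power_add power_0 mult_1_left mult_1_right mult_ac)
    then have "\<bar>B - C + \<rho> * (real 0 + (1 - p) * real (a - d) + p * real 0)\<bar>
      \<le> 2 * \<rho>\<^sup>2 * (real 0 + real (a - d) + real 0)"
      unfolding B_def C_def using ln_Lam_W_mult[OF nonneg_poly, of 0 "a - d" 0 p] assms by (simp only:)
    moreover have "real (a - d) = x" using assms(2) by (simp add: x_def)
    ultimately show ?thesis by (simp add: algebra_simps)
  qed
  have C: "\<bar>ln (rising_density h) - C + real k * \<rho>\<bar> \<le> \<rho>\<^sup>2 * x"
  proof -
    have "\<bar>ln (Lam ([:0, 1:] ^ k * [:0, 1:] ^ (d + v))) - C + real k * \<rho>\<bar> \<le> real k * (2 * \<rho>\<^sup>2)"
      unfolding C_def using hk(1) assms by (intro ln_Lam_X_power[OF nonneg_poly]) (auto simp: h_def)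
    moreover have "Lam ([:0, 1:] ^ k * [:0, 1:] ^ (d + v)) = rising_density h"
      unfolding power_add[symmetric] Lam_X_power hk(1) ..
    moreover have "real k * (2 * \<rho>\<^sup>2) \<le> x / 2 * (2 * \<rho>\<^sup>2)"
      using k r by (intro mult_right_mono) (auto simp: x_def)
    ultimately show ?thesis by (simp add: mult.commute)
  qed
  have G: "\<bar>ln (rising_density h) + real n * \<rho>\<^sup>2 / 24\<bar> \<le> 2 * \<rho> + 2 * (real n * \<rho> ^ 3)"
    using ln_rising_density_center[of h] by (simp add: h_def)
  have k2: "real k * \<rho> \<le> \<rho> * x / 2" "\<rho> * x / 2 - \<rho> / 2 \<le> real k * \<rho>"
    using mult_right_mono[OF k(1), of \<rho>] mult_right_mono[OF k(2), of \<rho>] r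
    by (auto simp: x_def algebra_simps diff_divide_distrib)
  have e: "real d * (\<rho>\<^sup>2 / real n + 5 * \<rho> ^ 3) \<le> \<rho> + 5 * (real n * \<rho> ^ 3)"
  proof -
    have "real d * (\<rho>\<^sup>2 / real n + 5 * \<rho> ^ 3) \<le> real n * (\<rho>\<^sup>2 / real n + 5 * \<rho> ^ 3)"
      using assms r by (intro mult_right_mono) auto
    also have "\<dots> = \<rho>\<^sup>2 + 5 * (real n * \<rho> ^ 3)" using n_pos by (simp add: algebra_simps)
    also have "\<rho>\<^sup>2 \<le> \<rho>" using r by (simp add: power2_eq_square)
    finally show ?thesis by simp
  qed
  have "\<bar>A - (- (real n * \<rho>\<^sup>2 / 24) + (p * (\<rho> * x) - \<rho> * x / 2) + real d * (p * (1 - p) * \<rho>\<^sup>2))\<bar>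
    \<le> 4 * \<rho> + 7 * (real n * \<rho> ^ 3) + 3 * (\<rho>\<^sup>2 * x)"
    using A B C G k2 e r by linarith
  moreover have "- (real n * \<rho>\<^sup>2 / 24) + (p * (\<rho> * x) - \<rho> * x / 2) + real d * (p * (1 - p) * \<rho>\<^sup>2) =
     - real n * \<rho>\<^sup>2 / 24 + (p - 1 / 2) * \<rho> * (real a - real d) + p * (1 - p) * \<rho>\<^sup>2 * real d"
    by (simp add: x_def algebra_simps diff_divide_distrib)
  ultimately show ?thesis by (simp only: A_def x_def mult.assoc)
qed

text \<open>
  The case of more descents than ascents follows by exchanging \<open>p\<close> with \<open>1 - p\<close>. The two cases have
  \<open>d\<close> respectively \<open>a\<close> matched pairs, and the difference goes into the error term.
\<close>

lemma ln_Lam_W_expansion: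
  assumes "a + d + 2 * v + 1 = n" "0 \<le> p" "p \<le> 1"
  shows "\<bar>ln (Lam (W p v a d)) -
      (- real n * \<rho>\<^sup>2 / 24 + (p - 1 / 2) * \<rho> * (real a - real d) + p * (1 - p) * \<rho>\<^sup>2 * real d)\<bar>
    \<le> 4 * \<rho> + 7 * real n * \<rho> ^ 3 + 4 * \<rho>\<^sup>2 * \<bar>real a - real d\<bar>"
proof (cases "d \<le> a")
  case True
  then have "3 * \<rho>\<^sup>2 * (real a - real d) \<le> 4 * \<rho>\<^sup>2 * \<bar>real a - real d\<bar>" by (intro mult_mono) auto
  with ln_Lam_W_expansion_aux[OF assms(1) True assms(2,3)] show ?thesis by linarith
next
  case False
  have "W p v a d = W (1 - p) v d a" by (simp add: W_def mult_ac del: mult_pCons_left mult_pCons_right)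
  moreover have "\<bar>ln (Lam (W (1 - p) v d a)) -
      (- real n * \<rho>\<^sup>2 / 24 + ((1 - p) - 1 / 2) * \<rho> * (real d - real a) + (1 - p) * (1 - (1 - p)) * \<rho>\<^sup>2 * real a)\<bar>
    \<le> 4 * \<rho> + 7 * real n * \<rho> ^ 3 + 3 * \<rho>\<^sup>2 * (real d - real a)"
    using assms False by (intro ln_Lam_W_expansion_aux) auto
  moreover have "((1 - p) - 1 / 2) * \<rho> * (real d - real a) = (p - 1 / 2) * \<rho> * (real a - real d)"
    by (simp add: field_simps)
  moreover have "(1 - p) * (1 - (1 - p)) * \<rho>\<^sup>2 * real a = p * (1 - p) * \<rho>\<^sup>2 * real d - p * (1 - p) * (\<rho>\<^sup>2 * (real d - real a))"
    by (simp add: algebra_simps)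
  moreover have "p * (1 - p) * (\<rho>\<^sup>2 * (real d - real a)) \<le> \<rho>\<^sup>2 * (real d - real a)"
    using False assms mult_le_one[of p "1 - p"] by (intro mult_left_le_one_le) auto
  moreover have "0 \<le> p * (1 - p) * (\<rho>\<^sup>2 * (real d - real a))" using False assms by simp
  moreover have "4 * \<rho>\<^sup>2 * \<bar>real a - real d\<bar> = 4 * (\<rho>\<^sup>2 * (real d - real a))"
    "3 * \<rho>\<^sup>2 * (real d - real a) = 3 * (\<rho>\<^sup>2 * (real d - real a))" using False by auto
  ultimately show ?thesis
    by (simp only: abs_le_iff) linarith
qed

lemma geo_power_nth: "fps_nth (geo ^ Suc N) k = real ((N + k) choose N)"
proof (induction N arbitrary: k)
  case 0 then show ?case by simp
next
  case (Suc N)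
  have "fps_nth (geo ^ Suc (Suc N)) k =
      (\<Sum>i\<le>k. fps_nth (geo ^ Suc N) i)"
    by (simp only: power_Suc2[of _ "Suc N"] fps_mult_nth atLeast0AtMost) simp
  also have "\<dots> = real (\<Sum>i\<le>k. (N + i) choose N)" unfolding Suc by simp
  also have "(\<Sum>i\<le>k. (N + i) choose N) = (Suc N + k) choose Suc N"
    using choose_rising_sum(1)[of N k] by simp
  finally show ?case .
qed

lemma rising_density_eq_choose:
  assumes "i < m"
  shows "rising_density i = fact n * real ((n + (m - 1 - i)) choose n) / real m ^ n"
proof -
  define k where "k = m - 1 - i"
  have k: "real k + 1 = real m - real i" using assms by (simp add: k_def of_nat_diff)
  have prod: "(\<Prod>j<N. real k + 1 + real j) * fact k = fact (N + k)" for N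
  proof (induction N)
    case (Suc N)
    have "(\<Prod>j<Suc N. real k + 1 + real j) * fact k = (\<Prod>j<N. real k + 1 + real j) * fact k * (real k + 1 + real N)"
      by (simp add: mult_ac)
    also have "\<dots> = fact (Suc N + k)" unfolding Suc by (simp add: algebra_simps)
    finally show ?case .
  qed simp
  have "real ((n + k) choose n) = fact (n + k) / (fact n * fact k)"
    by (subst binomial_fact) auto
  then have "fact n * real ((n + k) choose n) = (\<Prod>j<n. real k + 1 + real j)"
    unfolding prod[symmetric] by simp
  moreover have "rising_density i = (\<Prod>j<n. real k + 1 + real j) / real m ^ n"
  proof -
    have "1 + (real j - real i) / real m = (real k + 1 + real j) / real m" for j
      unfolding k using m_pos by (simp add: field_simps)
    then show ?thesis by (simp add: rising_density_def prod_dividef)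
  qed
  ultimately show ?thesis by (simp add: k_def)
qed

text \<open>
  The coefficient of \<open>x ^ k\<close> in \<open>(1 - x) ^ (- n - 1)\<close> is a binomial coefficient, and \<open>degree R < n\<close>
  keeps all exponents below \<open>m\<close>.
\<close>

lemma Lam_eq_fps_nth:
  assumes "degree R < n"
  shows "fact n * fps_nth (fps_X * (fps_of_poly R * geo ^ Suc n)) m / real m ^ n = Lam R"
proof -
  define G where "G = geo ^ Suc n"
  obtain m' where m': "m = Suc m'" using m_pos by (cases m) auto
  have "n \<le> m'" using m' m_large n_pos by simp
  have "fps_nth (fps_X * (fps_of_poly R * G)) m = (\<Sum>i\<le>m'. coeff R i * fps_nth G (m' - i))"
  proof -
    have "fps_nth (fps_X * (fps_of_poly R * G)) m = fps_nth (fps_of_poly R * G) m'"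
      unfolding m' by simp
    then show ?thesis by (simp only: fps_mult_nth atLeast0AtMost fps_of_poly_nth)
  qed
  also have "\<dots> = (\<Sum>i\<le>degree R. coeff R i * fps_nth G (m' - i))"
    using assms \<open>n \<le> m'\<close> by (intro sum.mono_neutral_right) (auto simp: coeff_eq_0)
  finally have "fact n * fps_nth (fps_X * (fps_of_poly R * G)) m / real m ^ n =
      (\<Sum>i\<le>degree R. coeff R i * (fact n * fps_nth G (m' - i) / real m ^ n))"
    by (simp add: sum_distrib_left sum_divide_distrib mult_ac)
  also have "\<dots> = (\<Sum>i\<le>degree R. coeff R i * rising_density i)"
  proof (intro sum.cong refl)
    fix i assume "i \<in> {..degree R}"
    then have "i < m" using assms \<open>n \<le> m'\<close> m' by simp
    then show "coeff R i * (fact n * fps_nth G (m' - i) / real m ^ n) = coeff R i * rising_density i"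
      unfolding rising_density_eq_choose[OF \<open>i < m\<close>] G_def geo_power_nth by (simp add: m')
  qed
  finally show ?thesis by (simp add: G_def Lam_def)
qed

lemma fps_of_poly_W:
  "fps_of_poly (W p v a d) = fps_X ^ v * (fps_const p + fps_const (1 - p) * fps_X) ^ a *
     (fps_const (1 - p) + fps_const p * fps_X) ^ d"
  by (simp add: W_def fps_of_poly_mult fps_of_poly_power fps_of_poly_pCons mult.assoc mult.commute[of fps_X]
      del: mult_pCons_left mult_pCons_right)

end

section \<open>Adjacent swaps and expectations under the shuffle\<close>

text \<open>
  For negative \<open>y\<close> the upper bound on \<open>exp y\<close> comes from the quadratic Taylor lower bound for \<open>exp (- y)\<close>.
\<close>

lemma exp_quadratic_bound:
  fixes y :: real
  assumes "\<bar>y\<bar> \<le> 1"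
  shows "\<bar>exp y - 1 - y\<bar> \<le> y\<^sup>2"
proof -
  have "exp y \<le> 1 + y + y\<^sup>2"
  proof (cases "y \<ge> 0")
    case True then show ?thesis using exp_bound[of y] assms by simp
  next
    case False
    define x where "x = - y"
    have x: "x \<ge> 0" "x \<le> 1" using False assms by (auto simp: x_def)
    have "1 \<le> (1 - x + x\<^sup>2) * (1 + x + x\<^sup>2 / 2)"
    proof -
      have "(1 - x + x\<^sup>2) * (1 + x + x\<^sup>2 / 2) = 1 + (x\<^sup>2 / 2 + x ^ 3 / 2 + x ^ 4 / 2)"
        by (simp add: field_simps power2_eq_square power3_eq_cube power4_eq_xxxx)
      then show ?thesis using x by simp
    qed
    also have "\<dots> \<le> (1 - x + x\<^sup>2) * exp x"
      using x exp_lower_Taylor_quadratic[of x] by (intro mult_left_mono) auto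
    finally have "exp (- x) \<le> 1 - x + x\<^sup>2" by (simp add: exp_minus field_simps)
    then show ?thesis by (simp add: x_def)
  qed
  then show ?thesis using exp_ge_add_one_self[of y] zero_le_power2[of y] by linarith
qed

lemma ascents_add_descents: "distinct \<pi> \<Longrightarrow> ascents \<pi> + descents \<pi> = length \<pi> - 1"
proof -
  assume "distinct \<pi>"
  then have "(of_bool (\<pi> ! i < \<pi> ! Suc i) + of_bool (\<pi> ! Suc i < \<pi> ! i) :: nat) = 1" if "i < length \<pi> - 1" for i
    using that nth_eq_iff_index_eq[of \<pi> i "Suc i"] by (auto simp: neq_iff)
  then show ?thesis unfolding ascents_def descents_def sum.distrib[symmetric] by simp
qed

definition swap_at :: "nat \<Rightarrow> 'a list \<Rightarrow> 'a list" where
  "swap_at i xs = xs[i := xs ! Suc i, Suc i := xs ! i]"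

lemma swap_at_nth:
  "Suc i < length xs \<Longrightarrow> j < length xs \<Longrightarrow>
    swap_at i xs ! j = (if j = i then xs ! Suc i else if j = Suc i then xs ! i else xs ! j)"
  by (auto simp: swap_at_def nth_list_update)

lemma length_swap_at [simp]: "length (swap_at i xs) = length xs"
  by (simp add: swap_at_def)

lemma swap_at_swap_at: "Suc i < length xs \<Longrightarrow> swap_at i (swap_at i xs) = xs"
  by (intro nth_equalityI) (auto simp: swap_at_nth)

lemma swap_at_permutation:
  "Suc i < length xs \<Longrightarrow> xs \<in> permutations_of_set A \<Longrightarrow> swap_at i xs \<in> permutations_of_set A"
  by (simp add: permutations_of_set_def swap_at_def set_swap distinct_swap)

text \<open>
  A swap of adjacent entries affects only nearby steps, so the change of a pattern count is bounded
  by the number of affected positions.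
\<close>

lemma abs_sum_local_le:
  fixes c :: "nat \<Rightarrow> real"
  assumes "finite K" "\<And>j. j < N \<Longrightarrow> \<bar>c j\<bar> \<le> 1" "\<And>j. j < N \<Longrightarrow> j \<notin> K \<Longrightarrow> c j = 0"
  shows "\<bar>\<Sum>j<N. c j\<bar> \<le> real (card K)"
proof -
  have "\<bar>\<Sum>j<N. c j\<bar> \<le> (\<Sum>j<N. \<bar>c j\<bar>)" by (rule sum_abs)
  also have "\<dots> = (\<Sum>j\<in>{..<N} \<inter> K. \<bar>c j\<bar>)"
    using assms(3) by (intro sum.mono_neutral_right) auto
  also have "\<dots> \<le> (\<Sum>j\<in>{..<N} \<inter> K. 1)" using assms(2) by (intro sum_mono) auto
  also have "\<dots> \<le> real (card K)" using assms(1) by (auto intro!: card_mono)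
  finally show ?thesis .
qed

lemma ascents_swap_at_bound:
  assumes "Suc i < length \<pi>"
  shows "\<bar>real (ascents (swap_at i \<pi>)) - real (ascents \<pi>)\<bar> \<le> 3"
proof -
  let ?c = "\<lambda>j. of_bool (swap_at i \<pi> ! j < swap_at i \<pi> ! Suc j) - of_bool (\<pi> ! j < \<pi> ! Suc j) :: real"
  have "\<bar>\<Sum>j<length \<pi> - 1. ?c j\<bar> \<le> real (card {i - 1, i, Suc i})"
    using assms by (intro abs_sum_local_le) (auto simp: swap_at_nth)
  also have "card {i - 1, i, Suc i} \<le> 3" by (auto simp: card_insert_if)
  finally show ?thesis by (simp add: ascents_def sum_subtractf)
qed

lemma valleys_swap_at_bound:
  assumes "Suc i < length \<pi>"
  shows "\<bar>real (valleys (swap_at i \<pi>)) - real (valleys \<pi>)\<bar> \<le> 4"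
proof -
  let ?c = "\<lambda>j. of_bool (swap_at i \<pi> ! Suc j < swap_at i \<pi> ! j \<and> swap_at i \<pi> ! Suc j < swap_at i \<pi> ! Suc (Suc j))
     - of_bool (\<pi> ! Suc j < \<pi> ! j \<and> \<pi> ! Suc j < \<pi> ! Suc (Suc j)) :: real"
  have "\<bar>\<Sum>j<length \<pi> - 2. ?c j\<bar> \<le> real (card {i - 2, i - 1, i, Suc i})"
    using assms by (intro abs_sum_local_le) (auto simp: swap_at_nth)
  also have "card {i - 2, i - 1, i, Suc i} \<le> 4" by (auto simp: card_insert_if)
  finally show ?thesis by (simp add: valleys_def sum_subtractf)
qed

definition lies_between :: "nat \<Rightarrow> nat \<Rightarrow> nat \<Rightarrow> bool" where
  "lies_between x y z \<longleftrightarrow> y < x \<and> x < z \<or> z < x \<and> x < y"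

definition sgn_step :: "nat \<Rightarrow> nat list \<Rightarrow> real" where
  "sgn_step i \<pi> = (if \<pi> ! i < \<pi> ! Suc i then 1 else - 1)"

lemma sum_sgn_step:
  assumes "distinct \<pi>"
  shows "(\<Sum>i<length \<pi> - 1. sgn_step i \<pi>) = real (ascents \<pi>) - real (descents \<pi>)"
proof -
  have "sgn_step i \<pi> = of_bool (\<pi> ! i < \<pi> ! Suc i) - of_bool (\<pi> ! Suc i < \<pi> ! i)" if "i < length \<pi> - 1" for i
    using that assms nth_eq_iff_index_eq[of \<pi> i "Suc i"] by (auto simp: sgn_step_def neq_iff)
  then show ?thesis by (simp add: ascents_def descents_def sum_subtractf)
qed

lemma sgn_step_swap_at:
  assumes "distinct \<pi>" "Suc i < length \<pi>"
  shows "sgn_step i (swap_at i \<pi>) = - sgn_step i \<pi>"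
  using assms nth_eq_iff_index_eq[of \<pi> i "Suc i"] by (auto simp: sgn_step_def swap_at_nth)

text \<open>
  The sign makes the contribution of step \<open>i\<close> itself to the \<open>i\<close>-th summand equal to \<open>- 1\<close> in all cases.
  A neighbouring step contributes \<open>1\<close> if the entry at its far end lies between the two swapped
  values, and \<open>0\<close> otherwise.
\<close>

lemma sum_sgn_step_ascents_swap_at:
  assumes "distinct \<pi>" "length \<pi> \<ge> 2"
  shows "(\<Sum>i<length \<pi> - 1. sgn_step i \<pi> * (real (ascents (swap_at i \<pi>)) - real (ascents \<pi>))) =
    - real (length \<pi> - 1) + (\<Sum>j<length \<pi> - 2.
        of_bool (lies_between (\<pi> ! j) (\<pi> ! Suc j) (\<pi> ! Suc (Suc j)))
      + of_bool (lies_between (\<pi> ! Suc (Suc j)) (\<pi> ! j) (\<pi> ! Suc j)))"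
proof -
  obtain N where N: "length \<pi> = Suc (Suc N)" using assms(2) by (metis add_2_eq_Suc le_Suc_ex)
  let ?L = "\<lambda>j. of_bool (lies_between (\<pi> ! j) (\<pi> ! Suc j) (\<pi> ! Suc (Suc j))) :: real"
  let ?R = "\<lambda>j. of_bool (lies_between (\<pi> ! Suc (Suc j)) (\<pi> ! j) (\<pi> ! Suc j)) :: real"
  let ?c = "\<lambda>i j. of_bool (swap_at i \<pi> ! j < swap_at i \<pi> ! Suc j) - of_bool (\<pi> ! j < \<pi> ! Suc j) :: real"
  have neq: "\<pi> ! i \<noteq> \<pi> ! j" if "i < Suc (Suc N)" "j < Suc (Suc N)" "i \<noteq> j" for i j
    using that assms(1) N by (simp add: nth_eq_iff_index_eq)
  \<comment> \<open>the swap at i changes only the steps i - 1, i and i + 1\<close>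
  have local: "sgn_step i \<pi> * ?c i j =
      (if j = i then - 1 else 0) + (if i = Suc j then ?L j else 0) + (if j = Suc i then ?R i else 0)"
    if "i < Suc N" "j < Suc N" for i j
  proof -
    consider "j = i" | "i = Suc j" | "j = Suc i" | "j \<noteq> i" "i \<noteq> Suc j" "j \<noteq> Suc i" by blast
    then show ?thesis
    proof cases
      case 1
      then show ?thesis using that neq[of i "Suc i"] by (auto simp: sgn_step_def swap_at_nth N)
    next
      case 2
      then show ?thesis using that neq[of j "Suc j"] neq[of j "Suc (Suc j)"] neq[of "Suc j" "Suc (Suc j)"]
        by (auto simp: sgn_step_def swap_at_nth N lies_between_def)
    next
      case 3
      then show ?thesis using that neq[of i "Suc i"] neq[of i "Suc (Suc i)"] neq[of "Suc i" "Suc (Suc i)"]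
        by (auto simp: sgn_step_def swap_at_nth N lies_between_def)
    next
      case 4
      then show ?thesis using that by (auto simp: swap_at_nth N)
    qed
  qed
  have "(\<Sum>i<Suc N. sgn_step i \<pi> * (real (ascents (swap_at i \<pi>)) - real (ascents \<pi>))) =
     (\<Sum>i<Suc N. \<Sum>j<Suc N. sgn_step i \<pi> * ?c i j)"
    by (simp only: ascents_def length_swap_at N diff_Suc_1 of_nat_sum of_nat_of_bool sum_subtractf[symmetric] sum_distrib_left)
  also have "\<dots> = (\<Sum>i<Suc N. \<Sum>j<Suc N. (if j = i then - 1 else 0) + (if i = Suc j then ?L j else 0) + (if j = Suc i then ?R i else 0))"
    using local by (intro sum.cong refl) auto
  also have "\<dots> = (\<Sum>i<Suc N. \<Sum>j<Suc N. (if j = i then - 1 else 0)) + (\<Sum>i<Suc N. \<Sum>j<Suc N. if i = Suc j then ?L j else 0)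
      + (\<Sum>i<Suc N. \<Sum>j<Suc N. if j = Suc i then ?R i else 0)"
    by (simp only: sum.distrib)
  also have "(\<Sum>i<Suc N. \<Sum>j<Suc N. (if j = i then - 1 else 0)) = - real (Suc N)" by simp
  also have "(\<Sum>i<Suc N. \<Sum>j<Suc N. if i = Suc j then ?L j else 0) = (\<Sum>j<Suc N. \<Sum>i<Suc N. if i = Suc j then ?L j else 0)"
    by (rule sum.swap)
  also have "\<dots> = (\<Sum>j<N. ?L j)" by (simp add: sum.delta' if_distrib del: sum.lessThan_Suc) simp
  also have "(\<Sum>i<Suc N. \<Sum>j<Suc N. if j = Suc i then ?R i else 0) = (\<Sum>j<N. ?R j)"
    by (simp add: sum.delta' del: sum.lessThan_Suc) simp
  finally show ?thesis by (simp add: N sum.distrib)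
qed

text \<open>
  Three cards are needed for a valley to fit.
\<close>

locale biased_shelves = many_shelves +
  fixes p :: real
  assumes n3: "n \<ge> 3" and p0: "0 < p" and p1: "p < 1"
begin

abbreviation "perms \<equiv> permutations_of_set {1..n}"

definition P :: "nat list \<Rightarrow> real" where "P \<pi> = pmf (shelf_shuffle n m p) \<pi>"

lemma length_perms: "\<pi> \<in> perms \<Longrightarrow> length \<pi> = n"
  by (auto simp: permutations_of_set_def distinct_card[symmetric])

lemma distinct_perms: "\<pi> \<in> perms \<Longrightarrow> distinct \<pi>"
  by (simp add: permutations_of_set_def)

lemma P_eq_Lam:
  assumes "\<pi> \<in> perms"
  obtains a d v where "fact n * P \<pi> = Lam (W p v a d)" "a + v = ascents \<pi>" "d + v = descents \<pi>"
    "v = valleys \<pi>" "a + d + 2 * v + 1 = n"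
proof -
  have \<pi>: "distinct \<pi>" "set \<pi> = {1..n}" "length \<pi> = n"
    using assms length_perms by (auto simp: permutations_of_set_def)
  obtain x zs where xzs: "rev \<pi> = x # zs" using \<pi>(3) n_pos by (cases "rev \<pi>") auto
  have d: "distinct (x # zs)" and l: "length (x # zs) = n" and r: "rev (x # zs) = \<pi>"
    using \<pi> xzs by (metis distinct_rev, metis length_rev, metis rev_rev_ident)
  obtain a d v where adv: "fst (last_label_gf p (x # zs)) + snd (last_label_gf p (x # zs)) =
     fps_X * geo ^ n * (fps_X ^ v * (fps_const p + fps_const (1 - p) * fps_X) ^ a * (fps_const (1 - p) + fps_const p * fps_X) ^ d)"
     "a + v = ascents \<pi>" "d + v = descents \<pi>" "v = valleys \<pi>"
    using last_label_gf_closed_form[OF d p0 p1] unfolding l r by blast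
  have sum: "a + d + 2 * v + 1 = n"
    using ascents_add_descents[OF \<pi>(1)] adv \<pi>(3) n_pos by simp
  have "degree (W p v a d) < n"
    using nonneg_poly_W[of p d a v] p0 p1 sum by (simp add: nonneg_poly_def)
  then have "Lam (W p v a d) = fact n * fps_nth (fps_X * (fps_of_poly (W p v a d) * geo ^ Suc n)) m / real m ^ n"
    by (rule Lam_eq_fps_nth[symmetric])
  also have "fps_X * (fps_of_poly (W p v a d) * geo ^ Suc n) = geo * (fst (last_label_gf p (rev \<pi>)) + snd (last_label_gf p (rev \<pi>)))"
    unfolding xzs adv(1) fps_of_poly_W by (simp add: mult_ac)
  also have "fact n * fps_nth \<dots> m / real m ^ n = fact n * P \<pi>"
    using pmf_shelf_shuffle_eq_nth[of p m n \<pi>] p0 p1 m_pos n_pos \<pi> by (simp add: P_def)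
  finally show ?thesis using adv sum by (intro that) auto
qed

lemma P_pos:
  assumes "\<pi> \<in> perms" shows "P \<pi> > 0"
proof -
  obtain a d v where *: "fact n * P \<pi> = Lam (W p v a d)" "a + d + 2 * v + 1 = n"
    using P_eq_Lam[OF assms] by metis
  have "Lam (W p v a d) > 0" using Lam_pos[OF nonneg_poly_W[of p d a v]] p0 p1 *(2) by simp
  then have "0 < fact n * P \<pi>" using * by simp
  then show ?thesis by (simp add: zero_less_mult_iff)
qed

lemma ln_P_expansion:
  assumes "\<pi> \<in> perms"
  shows "\<bar>ln (fact n * P \<pi>) -
      (- real n * \<rho>\<^sup>2 / 24 + (p - 1 / 2) * \<rho> * (real (ascents \<pi>) - real (descents \<pi>))
        + p * (1 - p) * \<rho>\<^sup>2 * (real (descents \<pi>) - real (valleys \<pi>)))\<bar>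
    \<le> 4 * \<rho> + 7 * real n * \<rho> ^ 3 + 4 * \<rho>\<^sup>2 * \<bar>real (ascents \<pi>) - real (descents \<pi>)\<bar>"
proof -
  obtain a d v where *: "fact n * P \<pi> = Lam (W p v a d)" "a + v = ascents \<pi>" "d + v = descents \<pi>"
    "v = valleys \<pi>" "a + d + 2 * v + 1 = n"
    using P_eq_Lam[OF assms] by blast
  have "real a = real (ascents \<pi>) - real (valleys \<pi>)" "real d = real (descents \<pi>) - real (valleys \<pi>)"
    using *(2-4) by (auto simp flip: of_nat_add simp: algebra_simps)
  then show ?thesis using ln_Lam_W_expansion[OF *(5), of p] p0 p1 by (simp add: *(1))
qed

text \<open>
  With \<open>A + D\<close> constant, the first order terms of \<open>ln_Lam_W_diff\<close> depend on \<open>A\<close> alone: the valley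
  count cancels because \<open>1 - (1 - p) - p = 0\<close>.
\<close>

lemma ln_P_diff:
  assumes "\<pi> \<in> perms" "\<sigma> \<in> perms"
  shows "\<bar>ln (P \<sigma>) - ln (P \<pi>) - (2 * p - 1) * \<rho> * (real (ascents \<sigma>) - real (ascents \<pi>))\<bar>
    \<le> 2 * \<rho>\<^sup>2 * (3 * \<bar>real (valleys \<sigma>) - real (valleys \<pi>)\<bar> + 2 * \<bar>real (ascents \<sigma>) - real (ascents \<pi>)\<bar>)"
proof -
  obtain a d v where 1: "fact n * P \<pi> = Lam (W p v a d)" "a + v = ascents \<pi>" "d + v = descents \<pi>"
    "v = valleys \<pi>" "a + d + 2 * v + 1 = n"
    using P_eq_Lam[OF assms(1)] by blast
  obtain a' d' v' where 2: "fact n * P \<sigma> = Lam (W p v' a' d')" "a' + v' = ascents \<sigma>" "d' + v' = descents \<sigma>"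
    "v' = valleys \<sigma>" "a' + d' + 2 * v' + 1 = n"
    using P_eq_Lam[OF assms(2)] by blast
  define x where "x = real (ascents \<sigma>) - real (ascents \<pi>)"
  define y where "y = real (valleys \<sigma>) - real (valleys \<pi>)"
  have y: "real v' - real v = y" using 1(4) 2(4) by (simp add: y_def)
  have a: "real a' - real a = x - y" using 1(2) 2(2) y unfolding x_def by (metis add_diff_add diff_add_cancel of_nat_add add_diff_cancel_right')
  have "real (a + d + 2 * v + 1) = real (a' + d' + 2 * v' + 1)" using 1(5) 2(5) by simp
  then have d: "real d' - real d = - x - y" using a y by simp
  have "ln (fact n * P \<sigma>) - ln (fact n * P \<pi>) = ln (P \<sigma>) - ln (P \<pi>)"
    using P_pos[OF assms(1)] P_pos[OF assms(2)] by (simp add: ln_mult_pos)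
  then have "\<bar>ln (P \<sigma>) - ln (P \<pi>) + \<rho> * (y + (1 - p) * (x - y) + p * (- x - y))\<bar> \<le> 2 * \<rho>\<^sup>2 * (\<bar>y\<bar> + \<bar>x - y\<bar> + \<bar>- x - y\<bar>)"
    using ln_Lam_W_diff[of d a v d' a' v' p] 1(1,5) 2(1,5) p0 p1 unfolding y a d by simp
  moreover have "\<rho> * (y + (1 - p) * (x - y) + p * (- x - y)) = - ((2 * p - 1) * \<rho> * x)"
    by (simp add: algebra_simps)
  moreover have "2 * \<rho>\<^sup>2 * (\<bar>y\<bar> + \<bar>x - y\<bar> + \<bar>- x - y\<bar>) \<le> 2 * \<rho>\<^sup>2 * (3 * \<bar>y\<bar> + 2 * \<bar>x\<bar>)"
    by (intro mult_left_mono) auto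
  ultimately show ?thesis unfolding x_def[symmetric] y_def[symmetric] by simp
qed

lemma P_swap_at:
  assumes "\<pi> \<in> perms" "Suc i < n"
  shows "\<bar>P (swap_at i \<pi>) - P \<pi> - (2 * p - 1) * \<rho> * (real (ascents (swap_at i \<pi>)) - real (ascents \<pi>)) * P \<pi>\<bar>
    \<le> 52 * \<rho>\<^sup>2 * P \<pi>"
proof -
  have r: "0 < \<rho>" "\<rho> \<le> 1/100" using rho_pos rho_le by auto
  have i: "Suc i < length \<pi>" using assms length_perms by simp
  have \<sigma>: "swap_at i \<pi> \<in> perms" using swap_at_permutation[OF i assms(1)] .
  define x where "x = real (ascents (swap_at i \<pi>)) - real (ascents \<pi>)"
  define y where "y = ln (P (swap_at i \<pi>)) - ln (P \<pi>)"
  have x: "\<bar>x\<bar> \<le> 3" unfolding x_def using ascents_swap_at_bound[OF i] .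
  have "\<bar>y - (2 * p - 1) * \<rho> * x\<bar> \<le> 2 * \<rho>\<^sup>2 * (3 * \<bar>real (valleys (swap_at i \<pi>)) - real (valleys \<pi>)\<bar> + 2 * \<bar>x\<bar>)"
    unfolding x_def y_def by (rule ln_P_diff[OF assms(1) \<sigma>])
  \<comment> \<open>a swap touches at most four valleys and three steps\<close>
  also have "\<dots> \<le> 2 * \<rho>\<^sup>2 * (3 * 4 + 2 * 3)"
    using x valleys_swap_at_bound[OF i] by (intro mult_left_mono add_mono) auto
  finally have y: "\<bar>y - (2 * p - 1) * \<rho> * x\<bar> \<le> 36 * \<rho>\<^sup>2" by simp
  have "\<rho>\<^sup>2 \<le> \<rho> * (1/100)" unfolding power2_eq_square using r by (intro mult_left_mono) auto
  moreover have "\<bar>(2 * p - 1) * \<rho> * x\<bar> \<le> 1 * \<rho> * 3"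
    unfolding abs_mult using x r p0 p1 by (intro mult_mono) auto
  ultimately have y4: "\<bar>y\<bar> \<le> 4 * \<rho>" using y r by linarith
  then have "y\<^sup>2 \<le> (4 * \<rho>)\<^sup>2" using r by (intro abs_le_square_iff[THEN iffD1]) linarith
  then have y2: "y\<^sup>2 \<le> 16 * \<rho>\<^sup>2" by (simp add: power_mult_distrib)
  have "\<bar>exp y - 1 - y\<bar> \<le> y\<^sup>2" using y4 r by (intro exp_quadratic_bound) auto
  then have "\<bar>exp y - 1 - (2 * p - 1) * \<rho> * x\<bar> \<le> 52 * \<rho>\<^sup>2" using y y2 by linarith
  then have "\<bar>exp y - 1 - (2 * p - 1) * \<rho> * x\<bar> * P \<pi> \<le> 52 * \<rho>\<^sup>2 * P \<pi>"
    using P_pos[OF assms(1)] by (intro mult_right_mono) auto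
  moreover have "P (swap_at i \<pi>) = exp y * P \<pi>"
    using P_pos[OF assms(1)] P_pos[OF \<sigma>] by (simp add: y_def exp_diff)
  then have "P (swap_at i \<pi>) - P \<pi> - (2 * p - 1) * \<rho> * x * P \<pi> = (exp y - 1 - (2 * p - 1) * \<rho> * x) * P \<pi>"
    by (simp add: algebra_simps)
  ultimately show ?thesis unfolding x_def[symmetric] using P_pos[OF assms(1)] by (simp add: abs_mult)
qed

definition expect :: "(nat list \<Rightarrow> real) \<Rightarrow> real" where
  "expect \<phi> = (\<Sum>\<pi>\<in>perms. P \<pi> * \<phi> \<pi>)"

lemma expect_const: "expect (\<lambda>_. c) = c"
proof -
  have "(\<Sum>\<pi>\<in>perms. P \<pi>) = 1"
    unfolding P_def using set_pmf_shelf_shuffle[OF m_pos] by (intro sum_pmf_eq_1) auto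
  then show ?thesis by (simp add: expect_def flip: sum_distrib_right)
qed

lemma expect_add: "expect (\<lambda>\<pi>. \<phi> \<pi> + \<psi> \<pi>) = expect \<phi> + expect \<psi>"
  by (simp add: expect_def distrib_left sum.distrib)

lemma expect_cmult: "expect (\<lambda>\<pi>. c * \<phi> \<pi>) = c * expect \<phi>"
  by (simp add: expect_def sum_distrib_left mult_ac)

lemma expect_diff: "expect (\<lambda>\<pi>. \<phi> \<pi> - \<psi> \<pi>) = expect \<phi> - expect \<psi>"
  by (simp add: expect_def right_diff_distrib sum_subtractf)

lemma expect_sum: "expect (\<lambda>\<pi>. \<Sum>i\<in>I. \<phi> i \<pi>) = (\<Sum>i\<in>I. expect (\<phi> i))"
  unfolding expect_def sum_distrib_left by (rule sum.swap)

lemma expect_cong: "(\<And>\<pi>. \<pi> \<in> perms \<Longrightarrow> \<phi> \<pi> = \<psi> \<pi>) \<Longrightarrow> expect \<phi> = expect \<psi>"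
  by (simp add: expect_def)

lemma expect_mono: "(\<And>\<pi>. \<pi> \<in> perms \<Longrightarrow> \<phi> \<pi> \<le> \<psi> \<pi>) \<Longrightarrow> expect \<phi> \<le> expect \<psi>"
  unfolding expect_def using P_pos by (intro sum_mono mult_left_mono) (auto simp: less_le)

lemma expect_abs_le: "\<bar>expect \<phi>\<bar> \<le> expect (\<lambda>\<pi>. \<bar>\<phi> \<pi>\<bar>)"
proof -
  have "expect \<phi> \<le> expect (\<lambda>\<pi>. \<bar>\<phi> \<pi>\<bar>)" by (intro expect_mono) auto
  moreover have "expect (\<lambda>\<pi>. - 1 * \<phi> \<pi>) \<le> expect (\<lambda>\<pi>. \<bar>\<phi> \<pi>\<bar>)" by (intro expect_mono) auto
  ultimately show ?thesis unfolding expect_cmult by linarith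
qed

text \<open>
  Swapping is an involution of the set of permutations, so it can be moved from \<open>\<phi>\<close> to \<open>P\<close>, where
  \<open>P_swap_at\<close> applies.
\<close>

lemma expect_swap_at:
  assumes "Suc i < n" "\<And>\<pi>. \<pi> \<in> perms \<Longrightarrow> \<bar>\<phi> \<pi>\<bar> \<le> 1"
  shows "\<bar>expect (\<lambda>\<pi>. \<phi> (swap_at i \<pi>)) - expect \<phi>
      - (2 * p - 1) * \<rho> * expect (\<lambda>\<pi>. \<phi> \<pi> * (real (ascents (swap_at i \<pi>)) - real (ascents \<pi>)))\<bar> \<le> 52 * \<rho>\<^sup>2"
proof -
  let ?x = "\<lambda>\<pi>. real (ascents (swap_at i \<pi>)) - real (ascents \<pi>)"
  have "expect (\<lambda>\<pi>. \<phi> (swap_at i \<pi>)) = (\<Sum>\<pi>\<in>perms. P (swap_at i \<pi>) * \<phi> \<pi>)"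
    unfolding expect_def
    using assms(1) by (intro sum.reindex_bij_witness[of _ "swap_at i" "swap_at i"])
      (auto simp: swap_at_swap_at length_perms swap_at_permutation)
  then have "expect (\<lambda>\<pi>. \<phi> (swap_at i \<pi>)) - expect \<phi> - (2 * p - 1) * \<rho> * expect (\<lambda>\<pi>. \<phi> \<pi> * ?x \<pi>) =
     (\<Sum>\<pi>\<in>perms. (P (swap_at i \<pi>) - P \<pi> - (2 * p - 1) * \<rho> * ?x \<pi> * P \<pi>) * \<phi> \<pi>)"
    unfolding expect_def by (simp add: sum_distrib_left sum_subtractf[symmetric] algebra_simps)
  also have "\<bar>\<dots>\<bar> \<le> (\<Sum>\<pi>\<in>perms. 52 * \<rho>\<^sup>2 * P \<pi>)"
  proof (intro order_trans[OF sum_abs] sum_mono)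
    fix \<pi> assume \<pi>: "\<pi> \<in> perms"
    have "\<bar>(P (swap_at i \<pi>) - P \<pi> - (2 * p - 1) * \<rho> * ?x \<pi> * P \<pi>) * \<phi> \<pi>\<bar> \<le> 52 * \<rho>\<^sup>2 * P \<pi> * 1"
      unfolding abs_mult[of _ "\<phi> \<pi>"] using P_swap_at[OF \<pi> assms(1)] assms(2)[OF \<pi>] P_pos[OF \<pi>]
      by (intro mult_mono) auto
    then show "\<bar>(P (swap_at i \<pi>) - P \<pi> - (2 * p - 1) * \<rho> * ?x \<pi> * P \<pi>) * \<phi> \<pi>\<bar> \<le> 52 * \<rho>\<^sup>2 * P \<pi>" by simp
  qed
  also have "\<dots> = expect (\<lambda>_. 52 * \<rho>\<^sup>2)" by (simp add: expect_def mult_ac)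
  finally show ?thesis by (simp only: expect_const)
qed

lemma expect_swap_at_crude:
  assumes "Suc i < n" "\<And>\<pi>. \<pi> \<in> perms \<Longrightarrow> \<bar>\<phi> \<pi>\<bar> \<le> 1"
  shows "\<bar>expect (\<lambda>\<pi>. \<phi> (swap_at i \<pi>)) - expect \<phi>\<bar> \<le> 4 * \<rho>"
proof -
  let ?x = "\<lambda>\<pi>. real (ascents (swap_at i \<pi>)) - real (ascents \<pi>)"
  have r: "0 < \<rho>" "\<rho> \<le> 1/100" using rho_pos rho_le by auto
  have "\<bar>expect (\<lambda>\<pi>. \<phi> \<pi> * ?x \<pi>)\<bar> \<le> expect (\<lambda>\<pi>. \<bar>\<phi> \<pi> * ?x \<pi>\<bar>)" by (rule expect_abs_le)
  also have "\<dots> \<le> expect (\<lambda>_. 3)"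
  proof (rule expect_mono)
    fix \<pi> assume \<pi>: "\<pi> \<in> perms"
    have "\<bar>\<phi> \<pi>\<bar> * \<bar>?x \<pi>\<bar> \<le> 1 * 3"
      using assms \<pi> ascents_swap_at_bound[of i \<pi>] by (intro mult_mono) (auto simp: length_perms)
    then show "\<bar>\<phi> \<pi> * ?x \<pi>\<bar> \<le> 3" by (simp add: abs_mult)
  qed
  finally have "\<bar>expect (\<lambda>\<pi>. \<phi> \<pi> * ?x \<pi>)\<bar> \<le> 3" by (simp only: expect_const)
  then have "\<bar>(2 * p - 1) * \<rho> * expect (\<lambda>\<pi>. \<phi> \<pi> * ?x \<pi>)\<bar> \<le> 1 * \<rho> * 3"
    unfolding abs_mult using r p0 p1 by (intro mult_mono) auto
  moreover have "\<rho>\<^sup>2 \<le> \<rho> * (1/100)" unfolding power2_eq_square using r by (intro mult_left_mono) auto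
  ultimately show ?thesis using expect_swap_at[of i \<phi>, OF assms] r by linarith
qed

text \<open>
  If \<open>R\<close> singles out one of any three distinct numbers, say the least or the median, then under the
  shuffle it is almost equally likely to sit in each of three adjacent positions, because swaps move it
  from one position to the next.
\<close>

lemma expect_position_of_three:
  fixes R :: "nat \<Rightarrow> nat \<Rightarrow> nat \<Rightarrow> bool"
  assumes one: "\<And>x y z. x \<noteq> y \<Longrightarrow> x \<noteq> z \<Longrightarrow> y \<noteq> z \<Longrightarrow> of_bool (R x y z) + of_bool (R y x z) + of_bool (R z x y) = (1::real)"
    and j: "Suc (Suc j) < n"
  shows "\<bar>expect (\<lambda>\<pi>. of_bool (R (\<pi> ! Suc j) (\<pi> ! j) (\<pi> ! Suc (Suc j)))) - 1 / 3\<bar> \<le> 3 * \<rho>"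
proof -
  let ?e0 = "\<lambda>\<pi>. of_bool (R (\<pi> ! j) (\<pi> ! Suc j) (\<pi> ! Suc (Suc j))) :: real"
  let ?e1 = "\<lambda>\<pi>. of_bool (R (\<pi> ! Suc j) (\<pi> ! j) (\<pi> ! Suc (Suc j))) :: real"
  let ?e2 = "\<lambda>\<pi>. of_bool (R (\<pi> ! Suc (Suc j)) (\<pi> ! j) (\<pi> ! Suc j)) :: real"
  have "expect (\<lambda>\<pi>. ?e0 \<pi> + ?e1 \<pi> + ?e2 \<pi>) = expect (\<lambda>_. 1)"
  proof (rule expect_cong)
    fix \<pi> assume "\<pi> \<in> perms"
    then have "\<pi> ! j \<noteq> \<pi> ! Suc j" "\<pi> ! j \<noteq> \<pi> ! Suc (Suc j)" "\<pi> ! Suc j \<noteq> \<pi> ! Suc (Suc j)"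
      using j distinct_perms length_perms by (simp_all add: nth_eq_iff_index_eq)
    then show "?e0 \<pi> + ?e1 \<pi> + ?e2 \<pi> = 1" by (rule one)
  qed
  then have "expect ?e0 + expect ?e1 + expect ?e2 = 1" by (simp add: expect_add expect_const)
  moreover have "\<bar>expect (\<lambda>\<pi>. ?e0 (swap_at j \<pi>)) - expect ?e0\<bar> \<le> 4 * \<rho>"
    using j by (intro expect_swap_at_crude) auto
  moreover have "expect (\<lambda>\<pi>. ?e0 (swap_at j \<pi>)) = expect ?e1"
    using j by (intro expect_cong) (simp add: swap_at_nth length_perms)
  moreover have "\<bar>expect (\<lambda>\<pi>. ?e1 (swap_at (Suc j) \<pi>)) - expect ?e1\<bar> \<le> 4 * \<rho>"
    using j by (intro expect_swap_at_crude) auto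
  moreover have "expect (\<lambda>\<pi>. ?e1 (swap_at (Suc j) \<pi>)) = expect ?e2"
    using j by (intro expect_cong) (simp add: swap_at_nth length_perms)
  ultimately show ?thesis using rho_pos by linarith
qed

lemma sum_thirds:
  assumes "\<And>j. j < n - 2 \<Longrightarrow> \<bar>e j - 1 / 3\<bar> \<le> 3 * \<rho>"
  shows "\<bar>(\<Sum>j<n - 2. e j) - (real n - 2) / 3\<bar> \<le> 3 * (real n * \<rho>)"
proof -
  have "(\<Sum>j<n - 2. e j) - (real n - 2) / 3 = (\<Sum>j<n - 2. e j - 1 / 3)"
    using n3 by (simp add: sum_subtractf of_nat_diff)
  also have "\<bar>\<dots>\<bar> \<le> (\<Sum>j<n - 2. 3 * \<rho>)"
    using assms by (intro order_trans[OF sum_abs] sum_mono) auto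
  also have "\<dots> = real (n - 2) * (3 * \<rho>)" by simp
  also have "\<dots> \<le> real n * (3 * \<rho>)" using rho_pos by (intro mult_right_mono) auto
  finally show ?thesis by simp
qed

lemma expect_valleys: "\<bar>expect (\<lambda>\<pi>. real (valleys \<pi>)) - (real n - 2) / 3\<bar> \<le> 3 * (real n * \<rho>)"
proof -
  let ?e = "\<lambda>j \<pi>. of_bool (\<pi> ! Suc j < \<pi> ! j \<and> \<pi> ! Suc j < \<pi> ! Suc (Suc j)) :: real"
  have "expect (\<lambda>\<pi>. real (valleys \<pi>)) = expect (\<lambda>\<pi>. \<Sum>j<n - 2. ?e j \<pi>)"
    by (intro expect_cong) (simp add: valleys_def length_perms)
  also have "\<dots> = (\<Sum>j<n - 2. expect (?e j))" by (rule expect_sum)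
  also have "\<bar>\<dots> - (real n - 2) / 3\<bar> \<le> 3 * (real n * \<rho>)"
    by (intro sum_thirds expect_position_of_three[where R = "\<lambda>x y z. x < y \<and> x < z"]) auto
  finally show ?thesis .
qed

text \<open>
  The median of three adjacent entries is in one of the two outer positions unless it is in the middle.
\<close>

lemma expect_outer_medians:
  "\<bar>expect (\<lambda>\<pi>. \<Sum>j<n - 2. of_bool (lies_between (\<pi> ! j) (\<pi> ! Suc j) (\<pi> ! Suc (Suc j)))
      + of_bool (lies_between (\<pi> ! Suc (Suc j)) (\<pi> ! j) (\<pi> ! Suc j))) - 2 * (real n - 2) / 3\<bar> \<le> 3 * (real n * \<rho>)"
proof -
  let ?e = "\<lambda>j \<pi>. of_bool (lies_between (\<pi> ! Suc j) (\<pi> ! j) (\<pi> ! Suc (Suc j))) :: real"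
  have one: "of_bool (lies_between x y z) + of_bool (lies_between y x z) + of_bool (lies_between z x y) = (1::real)"
    if "x \<noteq> y" "x \<noteq> z" "y \<noteq> z" for x y z
    using that by (auto simp: lies_between_def)
  have "expect (\<lambda>\<pi>. \<Sum>j<n - 2. of_bool (lies_between (\<pi> ! j) (\<pi> ! Suc j) (\<pi> ! Suc (Suc j)))
      + of_bool (lies_between (\<pi> ! Suc (Suc j)) (\<pi> ! j) (\<pi> ! Suc j))) = expect (\<lambda>\<pi>. \<Sum>j<n - 2. 1 - ?e j \<pi>)"
  proof (intro expect_cong sum.cong refl)
    fix \<pi> j assume "\<pi> \<in> perms" "j \<in> {..<n - 2}"
    then have "\<pi> ! j \<noteq> \<pi> ! Suc j" "\<pi> ! j \<noteq> \<pi> ! Suc (Suc j)" "\<pi> ! Suc j \<noteq> \<pi> ! Suc (Suc j)"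
      using distinct_perms length_perms by (simp_all add: nth_eq_iff_index_eq)
    from one[OF this] show "of_bool (lies_between (\<pi> ! j) (\<pi> ! Suc j) (\<pi> ! Suc (Suc j)))
      + of_bool (lies_between (\<pi> ! Suc (Suc j)) (\<pi> ! j) (\<pi> ! Suc j)) = 1 - ?e j \<pi>" by linarith
  qed
  also have "\<dots> = (real n - 2) - (\<Sum>j<n - 2. expect (?e j))"
    using n3 by (simp only: expect_sum expect_diff expect_const sum_subtractf) (simp add: of_nat_diff)
  finally have eq: "expect (\<lambda>\<pi>. \<Sum>j<n - 2. of_bool (lies_between (\<pi> ! j) (\<pi> ! Suc j) (\<pi> ! Suc (Suc j)))
      + of_bool (lies_between (\<pi> ! Suc (Suc j)) (\<pi> ! j) (\<pi> ! Suc j))) = (real n - 2) - (\<Sum>j<n - 2. expect (?e j))" .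
  have "\<bar>(\<Sum>j<n - 2. expect (?e j)) - (real n - 2) / 3\<bar> \<le> 3 * (real n * \<rho>)"
    by (intro sum_thirds expect_position_of_three one) (auto simp: lies_between_def)
  then show ?thesis unfolding eq by (simp add: field_simps)
qed

lemma abs_sgn_step: "\<bar>sgn_step i \<pi>\<bar> = 1" by (simp add: sgn_step_def)

text \<open>
  A swap at \<open>i\<close> negates \<open>sgn_step i\<close>, so \<open>expect_swap_at\<close> turns twice its expectation into
  \<open>- (2 * p - 1) * \<rho>\<close> times the expectation of the \<open>i\<close>-th summand in \<open>sum_sgn_step_ascents_swap_at\<close>. By
  \<open>expect_outer_medians\<close> these expectations add up to about \<open>- n / 3\<close>.
\<close>

lemma expect_ascents_minus_descents:
  "\<bar>expect (\<lambda>\<pi>. real (ascents \<pi>) - real (descents \<pi>)) - (2 * p - 1) * (real n * \<rho>) / 6\<bar>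
    \<le> \<rho> + 28 * (real n * \<rho>\<^sup>2)"
proof -
  let ?x = "\<lambda>i \<pi>. real (ascents (swap_at i \<pi>)) - real (ascents \<pi>)"
  define T where "T = (\<lambda>\<pi>. \<Sum>j<n - 2. of_bool (lies_between (\<pi> ! j) (\<pi> ! Suc j) (\<pi> ! Suc (Suc j)))
      + of_bool (lies_between (\<pi> ! Suc (Suc j)) (\<pi> ! j) (\<pi> ! Suc j)) :: real)"
  define X where "X = expect (\<lambda>\<pi>. real (ascents \<pi>) - real (descents \<pi>))"
  define Y where "Y = expect (\<lambda>\<pi>. \<Sum>i<n - 1. sgn_step i \<pi> * ?x i \<pi>)"
  have r: "0 < \<rho>" "\<rho> \<le> 1/100" using rho_pos rho_le by auto
  have nr: "0 \<le> real n * \<rho>" using r by simp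
  have step: "\<bar>2 * expect (sgn_step i) + (2 * p - 1) * \<rho> * expect (\<lambda>\<pi>. sgn_step i \<pi> * ?x i \<pi>)\<bar> \<le> 52 * \<rho>\<^sup>2"
    if "i < n - 1" for i
  proof -
    have "expect (\<lambda>\<pi>. sgn_step i (swap_at i \<pi>)) = expect (\<lambda>\<pi>. - 1 * sgn_step i \<pi>)"
      using that by (intro expect_cong) (simp add: sgn_step_swap_at distinct_perms length_perms)
    then have "expect (\<lambda>\<pi>. sgn_step i (swap_at i \<pi>)) = - expect (sgn_step i)"
      by (simp only: expect_cmult)
    moreover have "\<bar>expect (\<lambda>\<pi>. sgn_step i (swap_at i \<pi>)) - expect (sgn_step i)
      - (2 * p - 1) * \<rho> * expect (\<lambda>\<pi>. sgn_step i \<pi> * ?x i \<pi>)\<bar> \<le> 52 * \<rho>\<^sup>2"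
      using that by (intro expect_swap_at) (auto simp: abs_sgn_step)
    ultimately show ?thesis by linarith
  qed
  have "X = expect (\<lambda>\<pi>. \<Sum>i<n - 1. sgn_step i \<pi>)"
    unfolding X_def using sum_sgn_step by (intro expect_cong) (metis distinct_perms length_perms)
  then have "2 * X + (2 * p - 1) * \<rho> * Y =
     (\<Sum>i<n - 1. 2 * expect (sgn_step i) + (2 * p - 1) * \<rho> * expect (\<lambda>\<pi>. sgn_step i \<pi> * ?x i \<pi>))"
    by (simp only: Y_def expect_sum sum.distrib sum_distrib_left)
  also have "\<bar>\<dots>\<bar> \<le> (\<Sum>i<n - 1. 52 * \<rho>\<^sup>2)"
    using step by (intro order_trans[OF sum_abs] sum_mono) auto
  also have "\<dots> = real (n - 1) * (52 * \<rho>\<^sup>2)" by simp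
  also have "\<dots> \<le> real n * (52 * \<rho>\<^sup>2)" by (intro mult_right_mono) auto
  finally have X: "\<bar>2 * X + (2 * p - 1) * \<rho> * Y\<bar> \<le> 52 * (real n * \<rho>\<^sup>2)" by simp
  have "Y = expect (\<lambda>\<pi>. - real (n - 1) + T \<pi>)"
    unfolding Y_def
  proof (intro expect_cong)
    fix \<pi> assume \<pi>: "\<pi> \<in> perms"
    show "(\<Sum>i<n - 1. sgn_step i \<pi> * ?x i \<pi>) = - real (n - 1) + T \<pi>"
      using sum_sgn_step_ascents_swap_at[OF distinct_perms[OF \<pi>]] n3
      unfolding length_perms[OF \<pi>] T_def by simp
  qed
  also have "\<dots> = - (real n - 1) + expect T"
    using n3 by (simp add: expect_add expect_const of_nat_diff)
  finally have "Y = - (real n - 1) + expect T" .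
  then have Y: "\<bar>Y + real n / 3\<bar> \<le> 1 + 3 * (real n * \<rho>)"
    using expect_outer_medians unfolding T_def[symmetric] by (simp add: abs_le_iff field_simps)
  have "\<bar>(2 * p - 1) * \<rho> * (Y + real n / 3)\<bar> \<le> 1 * \<rho> * (1 + 3 * (real n * \<rho>))"
    unfolding abs_mult using Y r p0 p1 nr by (intro mult_mono) auto
  also have "\<dots> = \<rho> + 3 * (real n * \<rho>\<^sup>2)" by (simp add: algebra_simps power2_eq_square)
  finally have Z: "\<bar>(2 * p - 1) * \<rho> * (Y + real n / 3)\<bar> \<le> \<rho> + 3 * (real n * \<rho>\<^sup>2)" .
  have "(2 * p - 1) * \<rho> * (Y + real n / 3) = (2 * p - 1) * \<rho> * Y + 2 * ((2 * p - 1) * (real n * \<rho>) / 6)"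
    by (simp add: field_simps)
  moreover have "0 \<le> real n * \<rho>\<^sup>2" by simp
  ultimately show ?thesis unfolding X_def[symmetric] using X Z r by linarith
qed

text \<open>
  For steps that share no entry, a swap at one step negates the product of the signs, so the
  expectation of this product is nearly its own negative.
\<close>

lemma expect_square_ascents_minus_descents:
  "expect (\<lambda>\<pi>. (real (ascents \<pi>) - real (descents \<pi>))\<^sup>2) \<le> 3 * real n + 2 * (real n)\<^sup>2 * \<rho>"
proof -
  have r: "0 < \<rho>" using rho_pos by auto
  have pair: "expect (\<lambda>\<pi>. sgn_step i \<pi> * sgn_step j \<pi>) \<le> (if j \<in> {i - 1, i, Suc i} then 1 else 0) + 2 * \<rho>"
    if "i < n - 1" "j < n - 1" for i j
  proof (cases "j \<in> {i - 1, i, Suc i}")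
    case True
    have "expect (\<lambda>\<pi>. sgn_step i \<pi> * sgn_step j \<pi>) \<le> expect (\<lambda>_. 1)"
      by (intro expect_mono) (simp add: sgn_step_def)
    with True show ?thesis using r by (simp add: expect_const)
  next
    case False
    let ?\<phi> = "\<lambda>\<pi>. sgn_step i \<pi> * sgn_step j \<pi>"
    have "expect (\<lambda>\<pi>. ?\<phi> (swap_at i \<pi>)) = expect (\<lambda>\<pi>. - 1 * ?\<phi> \<pi>)"
    proof (intro expect_cong)
      fix \<pi> assume \<pi>: "\<pi> \<in> perms"
      have "sgn_step i (swap_at i \<pi>) = - sgn_step i \<pi>"
        using \<pi> that by (intro sgn_step_swap_at) (auto simp: distinct_perms length_perms)
      moreover have "sgn_step j (swap_at i \<pi>) = sgn_step j \<pi>"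
        using \<pi> that False by (auto simp: sgn_step_def swap_at_nth length_perms)
      ultimately show "?\<phi> (swap_at i \<pi>) = - 1 * ?\<phi> \<pi>" by simp
    qed
    then have "expect (\<lambda>\<pi>. ?\<phi> (swap_at i \<pi>)) = - expect ?\<phi>" by (simp only: expect_cmult)
    moreover have "\<bar>expect (\<lambda>\<pi>. ?\<phi> (swap_at i \<pi>)) - expect ?\<phi>\<bar> \<le> 4 * \<rho>"
      using that by (intro expect_swap_at_crude) (auto simp: abs_mult abs_sgn_step)
    ultimately show ?thesis using False by simp
  qed
  have "expect (\<lambda>\<pi>. (real (ascents \<pi>) - real (descents \<pi>))\<^sup>2) =
     expect (\<lambda>\<pi>. \<Sum>i<n - 1. \<Sum>j<n - 1. sgn_step i \<pi> * sgn_step j \<pi>)"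
  proof (intro expect_cong)
    fix \<pi> assume \<pi>: "\<pi> \<in> perms"
    show "(real (ascents \<pi>) - real (descents \<pi>))\<^sup>2 = (\<Sum>i<n - 1. \<Sum>j<n - 1. sgn_step i \<pi> * sgn_step j \<pi>)"
      using sum_sgn_step[OF distinct_perms[OF \<pi>]] length_perms[OF \<pi>]
      by (simp add: power2_eq_square flip: sum_product)
  qed
  also have "\<dots> = (\<Sum>i<n - 1. \<Sum>j<n - 1. expect (\<lambda>\<pi>. sgn_step i \<pi> * sgn_step j \<pi>))"
    by (simp only: expect_sum)
  also have "\<dots> \<le> (\<Sum>i<n - 1. \<Sum>j<n - 1. (if j \<in> {i - 1, i, Suc i} then 1 else 0) + 2 * \<rho>)"
    using pair by (intro sum_mono) auto
  also have "\<dots> \<le> (\<Sum>i<n - 1. 3 + 2 * (real n * \<rho>))"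
  proof (intro sum_mono)
    fix i
    have "(\<Sum>j<n - 1. if j \<in> {i - 1, i, Suc i} then 1 else 0 :: real) = real (card ({..<n - 1} \<inter> {i - 1, i, Suc i}))"
      by (simp add: sum.If_cases Int_def)
    also have "card ({..<n - 1} \<inter> {i - 1, i, Suc i}) \<le> card {i - 1, i, Suc i}" by (intro card_mono) auto
    also have "card {i - 1, i, Suc i} \<le> 3" by (auto simp: card_insert_if)
    finally have "(\<Sum>j<n - 1. if j \<in> {i - 1, i, Suc i} then 1 else 0 :: real) \<le> 3" by simp
    moreover have "(\<Sum>j<n - 1. 2 * \<rho>) \<le> 2 * (real n * \<rho>)"
      using r by (simp add: mult_right_mono)
    ultimately show "(\<Sum>j<n - 1. (if j \<in> {i - 1, i, Suc i} then 1 else 0) + 2 * \<rho>) \<le> 3 + 2 * (real n * \<rho>)"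
      by (simp only: sum.distrib)
  qed
  also have "\<dots> = real (n - 1) * (3 + 2 * (real n * \<rho>))" by simp
  also have "\<dots> \<le> real n * (3 + 2 * (real n * \<rho>))" using r by (intro mult_right_mono) auto
  finally show ?thesis by (simp add: algebra_simps power2_eq_square)
qed

lemma expect_abs_ascents_minus_descents:
  "expect (\<lambda>\<pi>. \<bar>real (ascents \<pi>) - real (descents \<pi>)\<bar>) \<le> sqrt (3 * real n + 2 * (real n)\<^sup>2 * \<rho>)"
proof -
  let ?x = "\<lambda>\<pi>. \<bar>real (ascents \<pi>) - real (descents \<pi>)\<bar>"
  define c where "c = expect ?x"
  \<comment> \<open>nonnegativity of the variance\<close>
  have "expect (\<lambda>\<pi>. (?x \<pi> - c)\<^sup>2) = expect (\<lambda>\<pi>. (real (ascents \<pi>) - real (descents \<pi>))\<^sup>2 - (2 * c) * ?x \<pi> + c\<^sup>2)"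
    by (intro expect_cong) (simp add: power2_diff)
  also have "\<dots> = expect (\<lambda>\<pi>. (real (ascents \<pi>) - real (descents \<pi>))\<^sup>2) - c\<^sup>2"
    by (simp only: expect_add expect_diff expect_cmult expect_const c_def[symmetric]) (simp add: power2_eq_square)
  moreover have "expect (\<lambda>_. 0) \<le> expect (\<lambda>\<pi>. (?x \<pi> - c)\<^sup>2)" by (intro expect_mono) auto
  ultimately have "c\<^sup>2 \<le> 3 * real n + 2 * (real n)\<^sup>2 * \<rho>"
    using expect_square_ascents_minus_descents by (simp add: expect_const)
  then show ?thesis unfolding c_def[symmetric] by (rule real_le_rsqrt)
qed

lemma Ent_eq_expect: "Ent n (shelf_shuffle n m p) = expect (\<lambda>\<pi>. ln (fact n * P \<pi>))"
  unfolding Ent_def expect_def P_def[symmetric]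
  by (intro sum.cong refl) (simp add: mult.commute)

text \<open>
  The three contributions to the coefficient of \<open>n * \<rho>\<^sup>2\<close> are \<open>- 1 / 24\<close>, \<open>(p - 1 / 2) * (2 * p - 1) / 6\<close> from
  \<open>A - D\<close>, and \<open>p * (1 - p) / 6\<close> from \<open>D - V\<close>, whose expectation is about \<open>n / 2 - n / 3\<close>. By
  \<open>4 * p * (1 - p) = 1 - (2 * p - 1)\<^sup>2\<close> they add up to \<open>(2 * p - 1)\<^sup>2 / 24\<close>.
\<close>

lemma Ent_estimate:
  "\<bar>Ent n (shelf_shuffle n m p) - (2 * p - 1)\<^sup>2 / 24 * (real n * \<rho>\<^sup>2)\<bar>
    \<le> 7 * \<rho> + 39 * (real n * \<rho>\<^sup>2 * \<rho>) + 4 * (\<rho>\<^sup>2 * sqrt (3 * real n + 2 * (real n)\<^sup>2 * \<rho>))"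
proof -
  define AD where "AD = expect (\<lambda>\<pi>. real (ascents \<pi>) - real (descents \<pi>))"
  define V where "V = expect (\<lambda>\<pi>. real (valleys \<pi>))"
  define absAD where "absAD = expect (\<lambda>\<pi>. \<bar>real (ascents \<pi>) - real (descents \<pi>)\<bar>)"
  define w where "w = p * (1 - p)"
  have r: "0 < \<rho>" "\<rho> \<le> 1/100" using rho_pos rho_le by auto
  have w: "0 \<le> w" "w \<le> 1" unfolding w_def using p0 p1 mult_le_one[of p "1 - p"] by auto
  have nr: "0 \<le> real n * \<rho>" using r by simp
  have D: "expect (\<lambda>\<pi>. real (descents \<pi>)) = (real n - 1 - AD) / 2"
  proof -
    have "AD + 2 * expect (\<lambda>\<pi>. real (descents \<pi>)) =
        expect (\<lambda>\<pi>. (real (ascents \<pi>) - real (descents \<pi>)) + 2 * real (descents \<pi>))"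
      by (simp only: AD_def expect_add expect_cmult)
    also have "\<dots> = expect (\<lambda>_. real n - 1)"
    proof (intro expect_cong)
      fix \<pi> assume \<pi>: "\<pi> \<in> perms"
      have "real (ascents \<pi> + descents \<pi>) = real (n - 1)"
        using ascents_add_descents[OF distinct_perms[OF \<pi>]] length_perms[OF \<pi>] by simp
      then show "(real (ascents \<pi>) - real (descents \<pi>)) + 2 * real (descents \<pi>) = real n - 1"
        using n3 by (simp add: of_nat_diff)
    qed
    finally show ?thesis by (simp add: expect_const)
  qed
  define main where "main = (\<lambda>\<pi>. - real n * \<rho>\<^sup>2 / 24 + (p - 1 / 2) * \<rho> * (real (ascents \<pi>) - real (descents \<pi>))
        + p * (1 - p) * \<rho>\<^sup>2 * (real (descents \<pi>) - real (valleys \<pi>)))"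
  have main: "expect main = - real n * \<rho>\<^sup>2 / 24 + (p - 1 / 2) * \<rho> * AD + w * \<rho>\<^sup>2 * ((real n - 1 - AD) / 2 - V)"
  proof -
    have A: "expect (\<lambda>\<pi>. real (ascents \<pi>)) = AD + (real n - 1 - AD) / 2"
    proof -
      have "AD = expect (\<lambda>\<pi>. real (ascents \<pi>)) - expect (\<lambda>\<pi>. real (descents \<pi>))"
        by (simp only: AD_def expect_diff)
      then show ?thesis using D by linarith
    qed
    show ?thesis
      by (simp only: main_def expect_add expect_diff expect_cmult expect_const A D V_def w_def) simp
  qed
  have "\<bar>Ent n (shelf_shuffle n m p) - expect main\<bar> \<le> expect (\<lambda>\<pi>. \<bar>ln (fact n * P \<pi>) - main \<pi>\<bar>)"
    unfolding Ent_eq_expect expect_diff[symmetric] by (rule expect_abs_le)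
  also have "\<dots> \<le> expect (\<lambda>\<pi>. (4 * \<rho> + 7 * real n * \<rho> ^ 3) + (4 * \<rho>\<^sup>2) * \<bar>real (ascents \<pi>) - real (descents \<pi>)\<bar>)"
    unfolding main_def by (intro expect_mono ln_P_expansion)
  also have "\<dots> = 4 * \<rho> + 7 * real n * \<rho> ^ 3 + 4 * \<rho>\<^sup>2 * absAD"
    by (simp only: expect_add expect_cmult expect_const absAD_def)
  also have "\<dots> \<le> 4 * \<rho> + 7 * real n * \<rho> ^ 3 + 4 * \<rho>\<^sup>2 * sqrt (3 * real n + 2 * (real n)\<^sup>2 * \<rho>)"
    unfolding absAD_def by (intro add_left_mono mult_left_mono expect_abs_ascents_minus_descents) auto
  finally have E: "\<bar>Ent n (shelf_shuffle n m p) - expect main\<bar>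
     \<le> 4 * \<rho> + 7 * (real n * \<rho>\<^sup>2 * \<rho>) + 4 * (\<rho>\<^sup>2 * sqrt (3 * real n + 2 * (real n)\<^sup>2 * \<rho>))"
    by (simp add: power2_eq_square power3_eq_cube mult.assoc)
  have AD: "\<bar>AD - (2 * p - 1) * (real n * \<rho>) / 6\<bar> \<le> \<rho> + 28 * (real n * \<rho>\<^sup>2)"
    unfolding AD_def by (rule expect_ascents_minus_descents)
  have V: "\<bar>V - (real n - 2) / 3\<bar> \<le> 3 * (real n * \<rho>)"
    unfolding V_def by (rule expect_valleys)
  have "\<bar>(p - 1 / 2) * \<rho> * (AD - (2 * p - 1) * (real n * \<rho>) / 6)\<bar> \<le> 1 * \<rho> * (\<rho> + 28 * (real n * \<rho>\<^sup>2))"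
    unfolding abs_mult using AD r p0 p1 by (intro mult_mono) auto
  then have 1: "\<bar>(p - 1 / 2) * \<rho> * (AD - (2 * p - 1) * (real n * \<rho>) / 6)\<bar> \<le> \<rho>\<^sup>2 + 28 * (real n * \<rho>\<^sup>2 * \<rho>)"
    by (simp add: algebra_simps power2_eq_square)
  have "\<rho>\<^sup>2 \<le> \<rho> * (1/100)" unfolding power2_eq_square using r by (intro mult_left_mono) auto
  then have r2: "\<rho>\<^sup>2 \<le> \<rho>" "real n * \<rho>\<^sup>2 \<le> real n * \<rho> / 100"
    using r mult_left_mono[of "\<rho>\<^sup>2" "\<rho> * (1/100)" "real n"] by (auto simp: mult.assoc)
  have "\<bar>(2 * p - 1) * (real n * \<rho>)\<bar> \<le> 1 * (real n * \<rho>)"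
    unfolding abs_mult using r p0 p1 by (intro mult_mono) auto
  then have "\<bar>AD\<bar> \<le> 1 + real n * \<rho>" using AD r r2 by linarith
  then have "\<bar>((real n - 1 - AD) / 2 - V) - real n / 6\<bar> \<le> 2 + 4 * (real n * \<rho>)"
  proof -
    have "\<bar>((N - 1 - A) / 2 - U) - N / 6\<bar> \<le> 2 + 4 * x"
      if "\<bar>A\<bar> \<le> 1 + x" "\<bar>U - (N - 2) / 3\<bar> \<le> 3 * x" "0 \<le> x" for N A U x :: real
      using that by (simp add: abs_le_iff field_simps)
    from this[OF \<open>\<bar>AD\<bar> \<le> 1 + real n * \<rho>\<close> V nr] show ?thesis .
  qed
  then have "\<bar>w * \<rho>\<^sup>2 * (((real n - 1 - AD) / 2 - V) - real n / 6)\<bar> \<le> 1 * \<rho>\<^sup>2 * (2 + 4 * (real n * \<rho>))"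
    unfolding abs_mult using w r by (intro mult_mono) auto
  then have 2: "\<bar>w * \<rho>\<^sup>2 * (((real n - 1 - AD) / 2 - V) - real n / 6)\<bar> \<le> 2 * \<rho>\<^sup>2 + 4 * (real n * \<rho>\<^sup>2 * \<rho>)"
    by (simp add: algebra_simps power2_eq_square)
  have "expect main = (2 * p - 1)\<^sup>2 / 24 * (real n * \<rho>\<^sup>2) + (p - 1 / 2) * \<rho> * (AD - (2 * p - 1) * (real n * \<rho>) / 6)
     + w * \<rho>\<^sup>2 * (((real n - 1 - AD) / 2 - V) - real n / 6)"
    unfolding main w_def by (simp add: field_simps power2_eq_square)
  then show ?thesis using E 1 2 r2 by linarith
qed

end

section \<open>The limit of the relative entropy\<close>

theorem theorem1p6:
  fixes p c :: real
  assumes "0 < p" "p < 1" "p \<noteq> 1/2" "c > 0"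
  shows "(\<lambda>n. Ent n (shelf_shuffle n (nat \<lfloor>c * real n powr (3/2)\<rfloor>) p))
           \<longlonglongrightarrow> (2 * p - 1)\<^sup>2 / (24 * c\<^sup>2)"
proof -
  define m where "m = (\<lambda>n. nat \<lfloor>c * real n powr (3/2)\<rfloor>)"
  define r where "r = (\<lambda>n. real n / real (m n))"
  have m: "real (m n) = of_int \<lfloor>c * real n powr (3/2)\<rfloor>" for n
    using assms(4) by (simp add: m_def)
  have "((\<lambda>n. sqrt (real n) * (real n / of_int \<lfloor>c * real n powr (3/2)\<rfloor>)) \<longlongrightarrow> inverse c) sequentially"
    using assms(4) by real_asymp
  then have t: "(\<lambda>n. sqrt (real n) * r n) \<longlonglongrightarrow> 1 / c" by (simp add: r_def m inverse_eq_divide)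
  have "eventually (\<lambda>n. 100 * real n \<le> of_int \<lfloor>c * real n powr (3/2)\<rfloor>) sequentially"
    using assms(4) by real_asymp
  then have large: "eventually (\<lambda>n. 100 * n \<le> m n) sequentially"
    by eventually_elim (simp flip: m)
  have nr2: "(\<lambda>n. real n * (r n)\<^sup>2) \<longlonglongrightarrow> 1 / c\<^sup>2"
    using tendsto_power[OF t, of 2] by (simp add: power_mult_distrib power_divide)
  have "(\<lambda>n. sqrt (real n) * r n * (1 / sqrt (real n))) \<longlonglongrightarrow> 1 / c * 0"
    by (intro tendsto_mult t) real_asymp
  moreover have "eventually (\<lambda>n. sqrt (real n) * r n * (1 / sqrt (real n)) = r n) sequentially"
    using eventually_gt_at_top[of 0] by eventually_elim simp
  ultimately have r0: "r \<longlonglongrightarrow> 0" by (simp add: tendsto_cong)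
  define err where "err = (\<lambda>n. 7 * r n + 39 * (real n * (r n)\<^sup>2 * r n)
     + 4 * ((r n)\<^sup>2 * sqrt (3 * real n + 2 * (real n)\<^sup>2 * r n)))"
  have "(\<lambda>n. sqrt (3 * (real n * (r n)\<^sup>2) * (r n)\<^sup>2 + 2 * (real n * (r n)\<^sup>2)\<^sup>2 * r n)) \<longlonglongrightarrow>
      sqrt (3 * (1 / c\<^sup>2) * 0\<^sup>2 + 2 * (1 / c\<^sup>2)\<^sup>2 * 0)"
    by (intro tendsto_intros nr2 r0)
  moreover have "sqrt (3 * (real n * (r n)\<^sup>2) * (r n)\<^sup>2 + 2 * (real n * (r n)\<^sup>2)\<^sup>2 * r n) =
      (r n)\<^sup>2 * sqrt (3 * real n + 2 * (real n)\<^sup>2 * r n)" for n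
  proof -
    have "3 * (real n * (r n)\<^sup>2) * (r n)\<^sup>2 + 2 * (real n * (r n)\<^sup>2)\<^sup>2 * r n =
        ((r n)\<^sup>2)\<^sup>2 * (3 * real n + 2 * (real n)\<^sup>2 * r n)"
      by (simp add: algebra_simps power2_eq_square)
    then show ?thesis by (simp only: real_sqrt_mult real_sqrt_abs) simp
  qed
  ultimately have "(\<lambda>n. (r n)\<^sup>2 * sqrt (3 * real n + 2 * (real n)\<^sup>2 * r n)) \<longlonglongrightarrow> 0" by simp
  then have "err \<longlonglongrightarrow> 7 * 0 + 39 * (1 / c\<^sup>2 * 0) + 4 * 0"
    unfolding err_def by (intro tendsto_intros nr2 r0)
  then have err: "err \<longlonglongrightarrow> 0" by simp
  have "eventually (\<lambda>n. norm (Ent n (shelf_shuffle n (m n) p) - (2 * p - 1)\<^sup>2 / 24 * (real n * (r n)\<^sup>2)) \<le> err n) sequentially"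
    using large eventually_ge_at_top[of 3]
  proof eventually_elim
    case (elim n)
    then interpret biased_shelves n "m n" p using assms by unfold_locales auto
    show ?case using Ent_estimate by (simp add: err_def r_def \<rho>_def)
  qed
  then have "(\<lambda>n. Ent n (shelf_shuffle n (m n) p) - (2 * p - 1)\<^sup>2 / 24 * (real n * (r n)\<^sup>2)) \<longlonglongrightarrow> 0"
    using err by (rule Lim_null_comparison)
  moreover have "(\<lambda>n. (2 * p - 1)\<^sup>2 / 24 * (real n * (r n)\<^sup>2)) \<longlonglongrightarrow> (2 * p - 1)\<^sup>2 / 24 * (1 / c\<^sup>2)"
    by (intro tendsto_mult tendsto_const nr2)
  ultimately have "(\<lambda>n. Ent n (shelf_shuffle n (m n) p) - (2 * p - 1)\<^sup>2 / 24 * (real n * (r n)\<^sup>2) +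
      (2 * p - 1)\<^sup>2 / 24 * (real n * (r n)\<^sup>2)) \<longlonglongrightarrow> 0 + (2 * p - 1)\<^sup>2 / 24 * (1 / c\<^sup>2)"
    by (rule tendsto_add)
  then show ?thesis by (simp add: m_def)
qed

end
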